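(* Let $A\in M_n(\mathbb C)$ be normal with eigenvalues $\lambda_1,\dots,\lambda_n$, let $q$ be a polynomial with $a_i=|q(\lambda_i)|^2>0$ for all $i$, and let $u$ be a Haar-distributed unit vector. With respect to $dp_1\cdots dp_{n-1}$ on the simplex, the density of the filtered weight vector $p^{(q)}$ is \[ f_q(p)=(n-1)!\,\frac{\prod_ia_i^{-1}}{\left(\sum_ip_i/a_i\right)^n}. \]
   Context: Work in an orthonormal eigenbasis of $A$, $Ae_i=\lambda_ie_i$. The simplex is $\Delta^{n-1}=\{p\in\mathbb R^n:p_i\ge0,\sum_ip_i=1\}$, with $p_1,\dots,p_{n-1}$ as coordinates. The filtered vector is $v=q(A)u/\|q(A)u\|$ and $p_i^{(q)}=|v_i|^2$; in distribution, $p_i^{(q)}=a_iE_i/\sum_ja_jE_j$ with $E_1,\dots,E_n$ independent exponential random variables of mean one. Haar-distributed means distributed according to the unitarily invariant probability measure on the unit sphere of $\mathbb C^n$. *)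

theory Defs
  imports "HOL-Probability.Probability" "HOL-Computational_Algebra.Polynomial"
begin

definition hinner :: "complex ^ 'n \<Rightarrow> complex ^ 'n \<Rightarrow> complex" where
  "hinner x y = (\<Sum>j\<in>UNIV. cnj (x $ j) * y $ j)"

definition adjoint_mat :: "complex ^ 'n ^ 'n \<Rightarrow> complex ^ 'n ^ 'n" where
  "adjoint_mat A = map_matrix cnj (transpose A)"

definition normal_mat :: "complex ^ 'n ^ 'n \<Rightarrow> bool" where
  "normal_mat A \<longleftrightarrow> A ** adjoint_mat A = adjoint_mat A ** A"

definition unitary_mat :: "complex ^ 'n ^ 'n \<Rightarrow> bool" where
  "unitary_mat U \<longleftrightarrow> U ** adjoint_mat U = mat 1 \<and> adjoint_mat U ** U = mat 1"

(* The library's \<open>^\<close> and \<open>*\<close> on the type \<open>vec\<close> act entrywise, hence a separate matrix power. *)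
primrec mat_power :: "complex ^ 'n ^ 'n \<Rightarrow> nat \<Rightarrow> complex ^ 'n ^ 'n" where
  "mat_power A 0 = mat 1"
| "mat_power A (Suc k) = A ** mat_power A k"

definition poly_mat :: "complex poly \<Rightarrow> complex ^ 'n ^ 'n \<Rightarrow> complex ^ 'n ^ 'n" where
  "poly_mat q A = (\<Sum>k\<le>degree q. map_matrix ((*) (coeff q k)) (mat_power A k))"

(* Basis vectors and eigenvalues are numbered \<open>1, \<dots>, n\<close> with \<open>n = CARD('n)\<close>; an orthonormal
   family of this length is automatically a basis. *)
definition orthonormal_eigenbasis ::
    "complex ^ 'n ^ 'n \<Rightarrow> (nat \<Rightarrow> complex ^ 'n) \<Rightarrow> (nat \<Rightarrow> complex) \<Rightarrow> bool" where
  "orthonormal_eigenbasis A e lam \<longleftrightarrow>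
     (\<forall>i\<in>{1..CARD('n)}. \<forall>j\<in>{1..CARD('n)}. hinner (e i) (e j) = (if i = j then 1 else 0)) \<and>
     (\<forall>i\<in>{1..CARD('n)}. A *v e i = lam i *s e i)"

(* The unitarily invariant probability measure on the unit sphere, regarded as a Borel measure on
   the whole space that is concentrated on the sphere. *)
definition haar_sphere :: "(complex ^ 'n) measure \<Rightarrow> bool" where
  "haar_sphere \<mu> \<longleftrightarrow>
     prob_space \<mu> \<and> sets \<mu> = sets borel \<and> (AE x in \<mu>. norm x = 1) \<and>
     (\<forall>U. unitary_mat U \<longrightarrow> distr \<mu> borel ((*v) U) = \<mu>)"

definition filtered_vector ::
    "complex ^ 'n ^ 'n \<Rightarrow> complex poly \<Rightarrow> complex ^ 'n \<Rightarrow> complex ^ 'n" where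
  "filtered_vector A q u = (poly_mat q A *v u) /\<^sub>R norm (poly_mat q A *v u)"

definition filtered_weights ::
    "complex ^ 'n ^ 'n \<Rightarrow> (nat \<Rightarrow> complex ^ 'n) \<Rightarrow> complex poly \<Rightarrow> complex ^ 'n \<Rightarrow> nat \<Rightarrow> real" where
  "filtered_weights A e q u =
     (\<lambda>i\<in>{1..CARD('n)}. (cmod (hinner (e i) (filtered_vector A q u)))\<^sup>2)"

(* The measure \<open>dp\<^sub>1 \<cdots> dp\<^sub>n\<^sub>-\<^sub>1\<close> on the simplex of all \<open>p = (p\<^sub>1, \<dots>, p\<^sub>n)\<close> with \<open>p\<^sub>i \<ge> 0\<close> and
   \<open>\<Sum>\<^sub>i p\<^sub>i = 1\<close>: Lebesgue measure on the corresponding region of \<open>(p\<^sub>1, \<dots>, p\<^sub>n\<^sub>-\<^sub>1)\<close>, pushed forward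
   along \<open>p\<^sub>n = 1 - p\<^sub>1 - \<cdots> - p\<^sub>n\<^sub>-\<^sub>1\<close>.  It is not normalised.  Meant for \<open>n \<ge> 1\<close>. *)
definition simplex_measure :: "nat \<Rightarrow> (nat \<Rightarrow> real) measure" where
  "simplex_measure n =
     distr
       (density (\<Pi>\<^sub>M i\<in>{1..<n}. lborel)
          (indicator {x. (\<forall>i\<in>{1..<n}. 0 \<le> x i) \<and> (\<Sum>i\<in>{1..<n}. x i) \<le> 1}))
       (\<Pi>\<^sub>M i\<in>{1..n}. borel)
       (\<lambda>x. x(n := 1 - (\<Sum>i\<in>{1..<n}. x i)))"

end

theory Submission
  imports Defs
begin

text \<open>
  In the coordinates \<open>w\<close> of \<open>u\<close> with respect to the eigenbasis, \<open>q(A)\<close> is diagonal, so the filtered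
  weights are \<open>a\<^sub>i |w\<^sub>i|\<^sup>2 / (\<Sum>j. a\<^sub>j |w\<^sub>j|\<^sup>2)\<close> (\<open>filtered_weights_eq_relative_weights\<close>).
  The passage from \<open>u\<close> to \<open>w\<close> is unitary, hence \<open>w\<close> is again Haar-distributed.

  There is only one unitarily invariant probability measure on the sphere (\<open>haar_sphere_unique\<close>): it
  gives equal mass to all balls of equal radius, and two measures with this property and the same
  positive and finite masses of balls agree on open sets (\<open>emeasure_open_eq_of_ball_eq\<close>). So \<open>w\<close> has
  the law of \<open>z / |z|\<close> for a Gaussian vector \<open>z\<close>, whose law is unitarily invariant because Lebesgue measure and the norm are; the
  invariance of Lebesgue measure is another case of \<open>emeasure_open_eq_of_ball_eq\<close>. The factor
  \<open>1 / |z|\<close> cancels in the weights.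

  The coordinates of \<open>z\<close> are independent, and \<open>a\<^sub>i |z\<^sub>i|\<^sup>2\<close> is exponentially distributed with rate
  \<open>1 / a\<^sub>i\<close> because the area of a disc is proportional to the square of its radius
  (\<open>distr_std_complex_normal_norm_sq\<close>). It remains to normalise independent exponential variables
  by their sum \<open>s\<close> (\<open>distr_normalized_exponentials\<close>). In the coordinates \<open>s\<close> and \<open>p\<close> the joint density is
  \<open>s ^ (n - 1) * (\<Prod>i. 1 / a\<^sub>i) * exp (- s * (\<Sum>i. p\<^sub>i / a\<^sub>i))\<close>, and the integral over \<open>s\<close> is
  \<open>(n - 1)! * (\<Prod>i. 1 / a\<^sub>i) / (\<Sum>i. p\<^sub>i / a\<^sub>i) ^ n\<close>.
\<close>

section \<open>Borel measures determined by their values on balls\<close>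

lemma measurable_indicator_ball:
  fixes \<mu> \<nu> :: "'a::{metric_space, second_countable_topology} measure"
  assumes \<mu>: "sets \<mu> = sets borel" and \<nu>: "sets \<nu> = sets borel"
  shows "(\<lambda>(x, y). indicator (ball x r) y :: ennreal) \<in> borel_measurable (\<mu> \<Otimes>\<^sub>M \<nu>)"
proof -
  have eq: "(\<lambda>(x, y). indicator (ball x r) y :: ennreal) = indicator {p. dist (fst p) (snd p) < r}"
    by (auto simp: fun_eq_iff indicator_def)
  have "open {p::'a \<times> 'a. dist (fst p) (snd p) < r}"
    by (intro open_Collect_less continuous_intros)
  then have "{p. dist (fst p) (snd p) < r} \<in> sets (borel :: ('a \<times> 'a) measure)" by simp
  then have "{p::'a \<times> 'a. dist (fst p) (snd p) < r} \<in> sets (\<mu> \<Otimes>\<^sub>M \<nu>)"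
    by (simp only: borel_prod[symmetric] sets_pair_measure_cong[OF \<mu> \<nu>])
  then show ?thesis unfolding eq by (rule borel_measurable_indicator)
qed

text \<open>
  Christensen's argument. At a point \<open>x\<close> of \<open>S\<close> in the open set \<open>U\<close>, the quotient
  \<open>\<nu> (U \<inter> ball x r) / h r\<close> equals \<open>1\<close> for all small \<open>r\<close>. By Fatou's lemma \<open>\<mu> U\<close> is at most the lower limit of
  the \<open>\<mu>\<close>-integrals of these quotients. Tonelli's theorem and the symmetry \<open>y \<in> ball x r \<longleftrightarrow> x \<in> ball y r\<close>
  turn each of these integrals into \<open>(1 / h r) * \<integral>\<^sup>+y\<in>U. \<mu> (ball y r) \<partial>\<nu>\<close>, which is \<open>\<nu> U\<close>.
\<close>

lemma emeasure_open_le_of_ball_eq: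
  fixes \<mu> \<nu> :: "'a::{metric_space, second_countable_topology} measure"
  assumes \<mu>: "sigma_finite_measure \<mu>" "sets \<mu> = sets borel"
    and \<nu>: "sigma_finite_measure \<nu>" "sets \<nu> = sets borel"
    and S: "AE x in \<mu>. x \<in> S" "AE x in \<nu>. x \<in> S"
    and ball: "\<And>x r. x \<in> S \<Longrightarrow> r > 0 \<Longrightarrow> emeasure \<mu> (ball x r) = h r"
      "\<And>x r. x \<in> S \<Longrightarrow> r > 0 \<Longrightarrow> emeasure \<nu> (ball x r) = h r"
    and h: "\<And>r. r > 0 \<Longrightarrow> 0 < h r \<and> h r < \<infinity>"
    and U: "open U"
  shows "emeasure \<mu> U \<le> emeasure \<nu> U"
proof -
  interpret \<mu>: sigma_finite_measure \<mu> by fact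
  interpret \<nu>: sigma_finite_measure \<nu> by fact
  interpret P: pair_sigma_finite \<mu> \<nu> ..
  note [measurable_cong] = \<mu>(2) \<nu>(2)
  have [measurable]: "U \<in> sets borel" using U by simp
  define r where "r m = inverse (real (Suc m))" for m
  have r_pos: "r m > 0" for m by (simp add: r_def)
  define f where "f m x = (\<integral>\<^sup>+y. indicator U y * indicator (ball x (r m)) y \<partial>\<nu>) / h (r m)" for m x
  note ind = measurable_indicator_ball[OF \<mu>(2) \<nu>(2)]
  have prod: "(\<lambda>(x, y). indicator U y * indicator (ball x (r m)) y :: ennreal) \<in> borel_measurable (\<mu> \<Otimes>\<^sub>M \<nu>)" for m
  proof -
    note [measurable] = ind[of "r m"]
    have "(\<lambda>p. indicator U (snd p) * (\<lambda>(x, y). indicator (ball x (r m)) y :: ennreal) p) \<in> borel_measurable (\<mu> \<Otimes>\<^sub>M \<nu>)"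
      by measurable
    then show ?thesis by (simp add: case_prod_beta')
  qed
  have f_meas [measurable]: "f m \<in> borel_measurable \<mu>" for m
    unfolding f_def using \<nu>.borel_measurable_nn_integral_fst[OF prod[of m]] by simp
  \<comment> \<open>small balls around a point of the open set lie inside it, so the quotient is eventually one\<close>
  have lim: "indicator U x \<le> liminf (\<lambda>m. f m x)" if "x \<in> S" for x
  proof (cases "x \<in> U")
    case True
    then obtain \<epsilon> where \<epsilon>: "\<epsilon> > 0" "ball x \<epsilon> \<subseteq> U" using U open_contains_ball by metis
    have "r \<longlonglongrightarrow> 0" unfolding r_def by (rule LIMSEQ_inverse_real_of_nat)
    then have ev: "\<forall>\<^sub>F m in sequentially. r m < \<epsilon>"
      using \<epsilon>(1) by (rule order_tendstoD)
    have "\<forall>\<^sub>F m in sequentially. 1 \<le> f m x"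
      using ev
    proof eventually_elim
      case (elim m)
      have "(\<lambda>y. indicator U y * indicator (ball x (r m)) y :: ennreal) = indicator (ball x (r m))"
        using \<epsilon>(2) elim by (auto simp: indicator_def fun_eq_iff)
      then have "(\<integral>\<^sup>+y. indicator U y * indicator (ball x (r m)) y \<partial>\<nu>) = h (r m)"
        using ball(2)[OF \<open>x \<in> S\<close> r_pos] by simp
      moreover have "h (r m) / h (r m) = 1"
        using h[OF r_pos[of m]] by (intro ennreal_divide_self) auto
      ultimately show ?case by (simp add: f_def)
    qed
    then have "1 \<le> liminf (\<lambda>m. f m x)" by (rule Liminf_bounded)
    then show ?thesis using True by simp
  qed simp
  have int_f: "integral\<^sup>N \<mu> (f m) = emeasure \<nu> U" for m
  proof -
    have "integral\<^sup>N \<mu> (f m) = (\<integral>\<^sup>+x. (\<integral>\<^sup>+y. indicator U y * indicator (ball x (r m)) y \<partial>\<nu>) \<partial>\<mu>) / h (r m)"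
      unfolding f_def
      by (rule nn_integral_divide) (use \<nu>.borel_measurable_nn_integral_fst[OF prod[of m]] in simp)
    also have "(\<integral>\<^sup>+x. (\<integral>\<^sup>+y. indicator U y * indicator (ball x (r m)) y \<partial>\<nu>) \<partial>\<mu>)
        = (\<integral>\<^sup>+y. (\<integral>\<^sup>+x. indicator U y * indicator (ball x (r m)) y \<partial>\<mu>) \<partial>\<nu>)"
      by (rule P.Fubini'[symmetric, OF prod])
    also have "\<dots> = (\<integral>\<^sup>+y. indicator U y * h (r m) \<partial>\<nu>)"
    proof (rule nn_integral_cong_AE, use S(2) in eventually_elim)
      case (elim y)
      have "(\<lambda>x. indicator U y * indicator (ball x (r m)) y :: ennreal)
          = (\<lambda>x. indicator U y * indicator (ball y (r m)) x)"
        by (auto simp: indicator_def fun_eq_iff dist_commute)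
      then show ?case using ball(1)[OF elim r_pos[of m]] by (simp add: nn_integral_cmult_indicator \<mu>(2))
    qed
    also have "\<dots> = emeasure \<nu> U * h (r m)"
      by (simp add: nn_integral_multc)
    finally show ?thesis
      using h[OF r_pos[of m]] mult_divide_eq_ennreal[of "h (r m)" "emeasure \<nu> U"] by auto
  qed
  have "emeasure \<mu> U = (\<integral>\<^sup>+x. indicator U x \<partial>\<mu>)" by simp
  also have "\<dots> \<le> (\<integral>\<^sup>+x. liminf (\<lambda>m. f m x) \<partial>\<mu>)"
    by (rule nn_integral_mono_AE) (use S(1) lim in auto)
  also have "\<dots> \<le> liminf (\<lambda>m. integral\<^sup>N \<mu> (f m))"
    by (rule nn_integral_liminf) measurable
  also have "\<dots> = emeasure \<nu> U" by (simp add: int_f Liminf_const)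
  finally show ?thesis .
qed

lemma emeasure_open_eq_of_ball_eq:
  fixes \<mu> \<nu> :: "'a::{metric_space, second_countable_topology} measure"
  assumes "sigma_finite_measure \<mu>" "sets \<mu> = sets borel"
    and "sigma_finite_measure \<nu>" "sets \<nu> = sets borel"
    and "AE x in \<mu>. x \<in> S" "AE x in \<nu>. x \<in> S"
    and "\<And>x r. x \<in> S \<Longrightarrow> r > 0 \<Longrightarrow> emeasure \<mu> (ball x r) = h r"
      "\<And>x r. x \<in> S \<Longrightarrow> r > 0 \<Longrightarrow> emeasure \<nu> (ball x r) = h r"
    and "\<And>r. r > 0 \<Longrightarrow> 0 < h r \<and> h r < \<infinity>"
    and "open U"
  shows "emeasure \<mu> U = emeasure \<nu> U"
  using emeasure_open_le_of_ball_eq[of \<mu> \<nu> S h U] emeasure_open_le_of_ball_eq[of \<nu> \<mu> S h U] assms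
  by (intro antisym) auto

text \<open>
  The volume of a ball depends on its radius only, and the preimage of a ball under a surjective
  isometry is a ball of the same radius, so the uniqueness above applies with all points as centres.
\<close>

lemma lborel_distr_isometry:
  fixes T T' :: "'a::euclidean_space \<Rightarrow> 'a"
  assumes iso: "\<And>x y. dist (T x) (T y) = dist x y" and inv: "\<And>x. T (T' x) = x"
  shows "distr lborel borel T = lborel"
proof -
  have cont: "continuous_on UNIV T"
    by (rule lipschitz_on_continuous_on[of 1]) (simp add: lipschitz_on_def iso)
  have [measurable]: "T \<in> borel_measurable borel"
    using cont by (rule borel_measurable_continuous_onI)
  have vimage: "T -` ball x r = ball (T' x) r" for x r
    using iso[of "T' x"] by (auto simp: inv)
  have balls: "emeasure (distr lborel borel T) (ball x r) = ennreal (unit_ball_vol (DIM('a)) * r ^ DIM('a))" if "r > 0" for x r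
    using that by (simp add: emeasure_distr vimage emeasure_ball)
  have sf: "sigma_finite_measure (distr lborel borel T)"
  proof
    show "\<exists>A. countable A \<and> A \<subseteq> sets (distr lborel borel T) \<and> \<Union> A = space (distr lborel borel T) \<and>
        (\<forall>a\<in>A. emeasure (distr lborel borel T) a \<noteq> \<infinity>)"
    proof (intro exI[of _ "range (\<lambda>m. ball 0 (real (Suc m)))"] conjI)
      have "x \<in> (\<Union>m. ball 0 (real (Suc m)))" for x :: 'a
        using reals_Archimedean2[of "norm x"] by (auto simp: dist_norm intro!: exI[of _ "nat \<lceil>norm x\<rceil>"]) linarith
      then show "\<Union>(range (\<lambda>m. ball 0 (real (Suc m)))) = space (distr lborel borel T)"
        by auto
    qed (use balls in auto)
  qed
  have "emeasure (distr lborel borel T) U = emeasure lborel U" if "open U" for U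
  proof (rule emeasure_open_eq_of_ball_eq[OF sf _ sigma_finite_lborel, where S = UNIV
        and h = "\<lambda>r. ennreal (unit_ball_vol (DIM('a)) * r ^ DIM('a))"])
  qed (use that balls in \<open>auto simp: emeasure_ball ennreal_less_top\<close>)
  from this[OF open_box] have "lborel = distr lborel borel T"
    by (intro lborel_eqI) (auto simp: emeasure_lborel_box_eq simp del: emeasure_distr)
  then show ?thesis by simp
qed

lemma prob_measure_eqI_open:
  fixes \<mu> \<nu> :: "'a::topological_space measure"
  assumes "prob_space \<mu>" "sets \<mu> = sets borel" "sets \<nu> = sets borel"
    and "\<And>U. open U \<Longrightarrow> emeasure \<mu> U = emeasure \<nu> U"
  shows "\<mu> = \<nu>"
proof (rule measure_eqI_generator_eq[where E = "Collect open" and \<Omega> = UNIV and A = "\<lambda>_. UNIV"])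
  show "emeasure \<mu> UNIV \<noteq> \<infinity>" for i :: nat
    using prob_space.emeasure_space_1[OF assms(1)] sets_eq_imp_space_eq[OF assms(2)] by simp
qed (use assms in \<open>auto simp: Int_stable_def borel_def\<close>)

section \<open>Unitary matrices and uniqueness of the Haar measure on the sphere\<close>

lemma hinner_norm: "hinner x x = of_real ((norm x)\<^sup>2)"
proof -
  have "(norm x)\<^sup>2 = (\<Sum>j\<in>UNIV. (cmod (x $ j))\<^sup>2)"
    by (simp add: norm_vec_def L2_set_def sum_nonneg)
  then show ?thesis
    by (simp only: hinner_def of_real_sum complex_norm_square mult.commute)
qed

lemma hinner_matrix: "(\<chi> i j. cnj (f i $ j)) *v x = (\<chi> i. hinner (f i) x)"
  by (simp add: matrix_vector_mult_def hinner_def)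

lemma cnj_hinner: "cnj (hinner x y) = hinner y x"
  by (simp add: hinner_def mult.commute)

lemma hinner_scale_right: "hinner x (c *s y) = c * hinner x y"
  by (simp add: hinner_def sum_distrib_left ac_simps)

lemma hinner_adjoint: "hinner x (U *v y) = hinner (adjoint_mat U *v x) y"
proof -
  have "hinner x (U *v y) = (\<Sum>i\<in>UNIV. \<Sum>j\<in>UNIV. cnj (x $ i) * (U $ i $ j * y $ j))"
    by (simp add: hinner_def matrix_vector_mult_def sum_distrib_left)
  also have "\<dots> = (\<Sum>j\<in>UNIV. \<Sum>i\<in>UNIV. cnj (x $ i) * (U $ i $ j * y $ j))"
    by (rule sum.swap)
  also have "\<dots> = hinner (adjoint_mat U *v x) y"
    by (simp add: hinner_def matrix_vector_mult_def adjoint_mat_def transpose_def map_matrix_def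
        sum_distrib_left sum_distrib_right ac_simps)
  finally show ?thesis .
qed

lemma unitary_adjoint_cancel:
  assumes "unitary_mat U"
  shows "U *v (adjoint_mat U *v x) = x" "adjoint_mat U *v (U *v x) = x"
  using assms by (simp_all add: unitary_mat_def matrix_vector_mul_assoc)

lemma norm_unitary:
  assumes "unitary_mat U"
  shows "norm (U *v x) = norm x"
proof -
  have "hinner (U *v x) (U *v x) = hinner x x"
    by (simp add: hinner_adjoint unitary_adjoint_cancel[OF assms])
  then have "(norm (U *v x))\<^sup>2 = (norm x)\<^sup>2"
    unfolding hinner_norm of_real_eq_iff .
  then show ?thesis by simp
qed

lemma dist_unitary: "unitary_mat U \<Longrightarrow> dist (U *v x) (U *v y) = dist x y"
  by (simp add: dist_norm norm_unitary flip: matrix_vector_mult_diff_distrib)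

lemma measurable_matrix_vector_mult [measurable]:
  "(*v) (U :: complex ^ 'n ^ 'n) \<in> borel_measurable borel"
  unfolding matrix_vector_mult_def
  by (intro borel_measurable_continuous_onI continuous_intros)

lemma complex_phase:
  obtains c :: complex where "c * z = of_real (cmod z)" "c * cnj c = 1"
proof
  show "cis (- Arg z) * z = of_real (cmod z)"
    by (subst (1) rcis_cmod_Arg[of z, symmetric]) (simp add: rcis_def cis_mult)
  show "cis (- Arg z) * cnj (cis (- Arg z)) = 1"
    by (simp add: cis_cnj cis_mult)
qed

text \<open>
  After \<open>y\<close> has been multiplied by a phase that makes its inner product with \<open>x\<close> real, a
  Householder reflection maps \<open>x\<close> to the result.
\<close>

lemma unitary_transitive:
  fixes x y :: "complex ^ 'n"
  assumes x: "norm x = 1" and y: "norm y = 1"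
  obtains U where "unitary_mat U" "U *v x = y"
proof -
  obtain c where c: "c * hinner x y = of_real (cmod (hinner x y))" "c * cnj c = 1"
    by (rule complex_phase)
  define \<rho> where "\<rho> = cmod (hinner x y)"
  define y' where "y' = c *s y"
  \<comment> \<open>The Householder reflection along the difference of two unit vectors exchanges them if their inner product is real.\<close>
  define w where "w = x - y'"
  \<comment> \<open>If \<open>w = 0\<close>, division by zero gives \<open>s = 0\<close>, and the reflection below is the identity, as it should be.\<close>
  define s where "s = 2 / hinner w w"
  \<comment> \<open>The reflection maps \<open>x\<close> to \<open>y' = c *s y\<close>; the factor \<open>cnj c\<close> removes the phase again.\<close>
  define U where "U = (\<chi> i j. cnj c * ((if i = j then 1 else 0) - s * w $ i * cnj (w $ j)))"
  have xx: "hinner x x = 1" and yy: "hinner y y = 1" by (simp_all add: hinner_norm x y)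
  have xy': "hinner x y' = of_real \<rho>"
    by (simp add: y'_def hinner_scale_right c \<rho>_def)
  then have y'x: "hinner y' x = of_real \<rho>"
    by (metis cnj_hinner complex_cnj_complex_of_real)
  have "hinner y' y' = cnj c * c * hinner y y"
    by (simp add: y'_def hinner_def sum_distrib_left ac_simps)
  then have y'y': "hinner y' y' = 1" using c(2) yy by (simp add: mult.commute)
  have diff: "hinner w v = hinner x v - hinner y' v" for v
    by (simp add: w_def hinner_def algebra_simps sum_subtractf)
  have diff': "hinner v w = hinner v x - hinner v y'" for v
    by (simp add: w_def hinner_def algebra_simps sum_subtractf)
  have wx: "hinner w x = 1 - of_real \<rho>" by (simp add: diff xx y'x)
  have ww: "hinner w w = 2 - 2 * of_real \<rho>" by (simp add: diff diff' xx y'x xy' y'y')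
  have s_real: "cnj s = s" by (simp add: s_def cnj_hinner)
  have s_sq: "s * s * hinner w w = 2 * s" by (simp add: s_def)
  have "(adjoint_mat U ** U) $ i $ j = mat 1 $ i $ j" for i j
  proof -
    let ?d = "\<lambda>a b. if a = b then 1 else 0 :: complex"
    have "(adjoint_mat U ** U) $ i $ j
        = (\<Sum>k\<in>UNIV. cnj (U $ k $ i) * U $ k $ j)"
      by (simp add: matrix_matrix_mult_def adjoint_mat_def transpose_def map_matrix_def)
    also have "\<dots> = (\<Sum>k\<in>UNIV. c * cnj c * (?d k i * ?d k j - s * w $ i * (?d k j * cnj (w $ k))
        - s * cnj (w $ j) * (?d k i * w $ k) + s * s * w $ i * cnj (w $ j) * (cnj (w $ k) * w $ k)))"
      by (intro sum.cong) (simp_all add: U_def s_real algebra_simps)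
    also have "\<dots> = ?d i j - s * w $ i * cnj (w $ j) - s * cnj (w $ j) * w $ i
        + s * s * w $ i * cnj (w $ j) * hinner w w"
      unfolding c(2) mult_1 sum.distrib sum_subtractf sum_distrib_left[symmetric] hinner_def
      by (simp add: if_distrib[where f = "\<lambda>x. x * _"] cong: if_cong)
    also have "\<dots> = ?d i j"
      using s_sq by (auto simp: algebra_simps)
    finally show ?thesis by (simp add: mat_def)
  qed
  then have "adjoint_mat U ** U = mat 1" by (simp add: vec_eq_iff)
  then have unitary: "unitary_mat U"
    unfolding unitary_mat_def using matrix_left_right_inverse by blast
  have "(U *v x) $ i = y $ i" for i
  proof -
    have "(U *v x) $ i = (\<Sum>j\<in>UNIV. cnj c * ((if i = j then x $ j else 0) - s * w $ i * (cnj (w $ j) * x $ j)))"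
      unfolding matrix_vector_mult_def U_def by (auto intro!: sum.cong simp: algebra_simps)
    also have "\<dots> = cnj c * (x $ i - s * w $ i * hinner w x)"
      unfolding sum_distrib_left[symmetric] sum_subtractf hinner_def by simp
    also have "s * w $ i * hinner w x = w $ i"
    proof (cases "w = 0")
      case False
      then have "hinner w w \<noteq> 0" by (simp add: hinner_norm)
      moreover have "2 * hinner w x = hinner w w" by (simp add: wx ww)
      ultimately show ?thesis by (simp add: s_def field_simps)
    qed simp
    also have "cnj c * (x $ i - w $ i) = (c * cnj c) * y $ i"
      by (simp add: w_def y'_def)
    finally show ?thesis using c(2) by simp
  qed
  then have "U *v x = y" by (simp add: vec_eq_iff)
  with unitary that show thesis by blast
qed

lemma haar_sphere_ball_eq:
  assumes \<mu>: "haar_sphere \<mu>" and x: "norm x = 1" and y: "norm y = 1"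
  shows "emeasure \<mu> (ball x r) = emeasure \<mu> (ball y r)"
proof -
  obtain U where U: "unitary_mat U" "U *v x = y" using unitary_transitive[OF x y] .
  have sets: "sets \<mu> = sets borel" and inv: "distr \<mu> borel ((*v) U) = \<mu>"
    using \<mu> U by (auto simp: haar_sphere_def)
  note [measurable_cong] = sets
  have vimage: "(*v) U -` ball y r = ball x r"
    using dist_unitary[OF U(1), of x] by (auto simp: U(2))
  have "emeasure \<mu> (ball y r) = emeasure (distr \<mu> borel ((*v) U)) (ball y r)" by (simp add: inv)
  also have "\<dots> = emeasure \<mu> (ball x r)"
    using sets_eq_imp_space_eq[OF sets] by (subst emeasure_distr) (auto simp: vimage)
  finally show ?thesis by simp
qed

text \<open>
  Finitely many balls of radius \<open>r\<close> with centres on the sphere cover it, and all of them have the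
  same measure; that measure cannot vanish because the sphere carries the total mass \<open>1\<close>.
\<close>

lemma haar_sphere_ball_pos:
  fixes x :: "complex ^ 'n"
  assumes \<mu>: "haar_sphere \<mu>" and x: "norm x = 1" and r: "r > 0"
  shows "emeasure \<mu> (ball x r) > 0"
proof (rule ccontr)
  assume "\<not> emeasure \<mu> (ball x r) > 0"
  then have null: "emeasure \<mu> (ball y r) = 0" if "norm y = 1" for y
    using haar_sphere_ball_eq[OF \<mu> x that] by (simp add: not_gr_zero)
  interpret prob_space \<mu> using \<mu> by (simp add: haar_sphere_def)
  have sets: "sets \<mu> = sets borel" using \<mu> by (simp add: haar_sphere_def)
  have "compact (sphere (0 :: complex ^ 'n) 1)" by simp
  then have "\<forall>e>0. \<exists>K. finite K \<and> K \<subseteq> sphere (0 :: complex ^ 'n) 1 \<and> sphere 0 1 \<subseteq> (\<Union>y\<in>K. ball y e)"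
    using compact_imp_seq_compact seq_compact_imp_totally_bounded by metis
  with r obtain K where K: "finite K" "K \<subseteq> sphere (0 :: complex ^ 'n) 1" "sphere 0 1 \<subseteq> (\<Union>y\<in>K. ball y r)"
    by meson
  have "(\<Union>y\<in>K. ball y r) \<in> null_sets \<mu>"
  proof (rule null_sets_UN'[OF countable_finite[OF K(1)]])
    fix y assume "y \<in> K"
    then have "norm y = 1" using K(2) by auto
    then show "ball y r \<in> null_sets \<mu>" using null by (intro null_setsI) (simp_all add: sets)
  qed
  then have "AE y in \<mu>. y \<notin> (\<Union>y\<in>K. ball y r)" by (rule AE_not_in)
  moreover have "AE y in \<mu>. norm y = 1" using \<mu> by (simp add: haar_sphere_def)
  ultimately have "AE y in \<mu>. False"
    by eventually_elim (use K(3) in \<open>auto simp: subset_iff\<close>)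
  then show False by simp
qed

text \<open>
  By transitivity of the unitary group, each of the two measures gives equal mass to all balls of
  equal radius with centre on the sphere. Since both are probability measures, integrating
  the indicator of \<open>dist x y < r\<close> in both orders shows that these masses agree for the two measures.
\<close>

lemma haar_sphere_unique:
  assumes \<mu>: "haar_sphere \<mu>" and \<nu>: "haar_sphere \<nu>"
  shows "\<mu> = (\<nu> :: (complex ^ 'n) measure)"
proof (rule prob_measure_eqI_open)
  interpret \<mu>: prob_space \<mu> using \<mu> by (simp add: haar_sphere_def)
  interpret \<nu>: prob_space \<nu> using \<nu> by (simp add: haar_sphere_def)
  interpret P: pair_sigma_finite \<mu> \<nu> ..
  show "prob_space \<mu>" by (rule \<mu>.prob_space_axioms)
  show sets: "sets \<mu> = sets borel" "sets \<nu> = sets borel"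
    using \<mu> \<nu> by (auto simp: haar_sphere_def)
  have AE: "AE x in \<mu>. x \<in> sphere 0 1" "AE x in \<nu>. x \<in> sphere 0 1"
    using \<mu> \<nu> by (auto simp: haar_sphere_def)
  define h where "h r = emeasure \<mu> (ball (axis undefined 1 :: complex ^ 'n) r)" for r
  define k where "k r = emeasure \<nu> (ball (axis undefined 1 :: complex ^ 'n) r)" for r
  have h: "emeasure \<mu> (ball x r) = h r" if "x \<in> sphere 0 1" for x r
    using that haar_sphere_ball_eq[OF \<mu>, of x "axis undefined 1"] by (simp add: h_def)
  have k: "emeasure \<nu> (ball x r) = k r" if "x \<in> sphere 0 1" for x r
    using that haar_sphere_ball_eq[OF \<nu>, of x "axis undefined 1"] by (simp add: k_def)
  have hk: "h r = k r" for r
  proof -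
    have "k r = (\<integral>\<^sup>+x. k r \<partial>\<mu>)" by (simp add: \<mu>.emeasure_space_1)
    also have "\<dots> = (\<integral>\<^sup>+x. (\<integral>\<^sup>+y. indicator (ball x r) y \<partial>\<nu>) \<partial>\<mu>)"
      by (rule nn_integral_cong_AE) (use AE(1) in \<open>auto simp: k sets\<close>)
    also have "\<dots> = (\<integral>\<^sup>+y. (\<integral>\<^sup>+x. indicator (ball x r) y \<partial>\<mu>) \<partial>\<nu>)"
      by (rule P.Fubini'[symmetric], rule measurable_indicator_ball[OF sets])
    also have "\<dots> = (\<integral>\<^sup>+y. h r \<partial>\<nu>)"
    proof (rule nn_integral_cong_AE, use AE(2) in eventually_elim)
      case (elim y)
      have "(\<lambda>x. indicator (ball x r) y :: ennreal) = indicator (ball y r)"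
        by (auto simp: indicator_def fun_eq_iff dist_commute)
      then show ?case using h[OF elim] by (simp add: sets)
    qed
    also have "\<dots> = h r" by (simp add: \<nu>.emeasure_space_1)
    finally show ?thesis by simp
  qed
  have k': "emeasure \<nu> (ball x r) = h r" if "x \<in> sphere 0 1" for x r
    using k[OF that] by (simp add: hk)
  have h_fin: "0 < h r \<and> h r < \<infinity>" if "r > 0" for r
    using haar_sphere_ball_pos[OF \<mu> _ that, of "axis undefined 1"]
    by (simp add: h_def \<mu>.emeasure_finite less_top[symmetric])
  show "emeasure \<mu> U = emeasure \<nu> U" if "open U" for U
    by (rule emeasure_open_eq_of_ball_eq[OF \<mu>.sigma_finite_measure_axioms sets(1)
          \<nu>.sigma_finite_measure_axioms sets(2) AE h k' h_fin that])
qed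

section \<open>Finite products of measures\<close>

lemma distr_PiM_coordinatewise:
  fixes M :: "'i \<Rightarrow> 'a measure" and N :: "'i \<Rightarrow> 'b measure"
  assumes I: "finite I"
    and M: "\<And>i. sigma_finite_measure (M i)"
    and f [measurable]: "\<And>i. f i \<in> measurable (M i) (N i)"
    and D: "\<And>i. sigma_finite_measure (distr (M i) (N i) (f i))"
  shows "distr (PiM I M) (PiM I N) (\<lambda>x. \<lambda>i\<in>I. f i (x i)) = PiM I (\<lambda>i. distr (M i) (N i) (f i))"
proof -
  interpret M: product_sigma_finite M using M by (simp add: product_sigma_finite_def)
  interpret D: product_sigma_finite "\<lambda>i. distr (M i) (N i) (f i)"
    using D by (simp add: product_sigma_finite_def)
  note [measurable] = f
  have meas [measurable]: "(\<lambda>x. \<lambda>i\<in>I. f i (x i)) \<in> measurable (PiM I M) (PiM I N)"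
    by measurable
  show ?thesis
  proof (rule D.PiM_eqI[OF I])
    fix A assume "\<And>i. i \<in> I \<Longrightarrow> A i \<in> sets (distr (M i) (N i) (f i))"
    then have A [measurable]: "i \<in> I \<Longrightarrow> A i \<in> sets (N i)" for i by simp
    have "(\<lambda>x. \<lambda>i\<in>I. f i (x i)) -` Pi\<^sub>E I A \<inter> space (PiM I M) = Pi\<^sub>E I (\<lambda>i. f i -` A i \<inter> space (M i))"
      by (auto simp: space_PiM PiE_iff)
    then show "emeasure (distr (PiM I M) (PiM I N) (\<lambda>x. \<lambda>i\<in>I. f i (x i))) (Pi\<^sub>E I A)
        = (\<Prod>i\<in>I. emeasure (distr (M i) (N i) (f i)) (A i))"
      using I A by (subst emeasure_distr)
        (auto simp: M.emeasure_PiM emeasure_distr intro!: prod.cong sets_PiM_I_finite measurable_sets[OF f])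
  qed (simp cong: sets_PiM_cong)
qed

lemma PiM_density:
  fixes M :: "'i \<Rightarrow> 'a measure"
  assumes I: "finite I"
    and M: "\<And>i. sigma_finite_measure (M i)"
    and f [measurable]: "\<And>i. f i \<in> borel_measurable (M i)"
    and D: "\<And>i. sigma_finite_measure (density (M i) (f i))"
  shows "PiM I (\<lambda>i. density (M i) (f i)) = density (PiM I M) (\<lambda>x. \<Prod>i\<in>I. f i (x i))"
proof -
  interpret M: product_sigma_finite M using M by (simp add: product_sigma_finite_def)
  interpret D: product_sigma_finite "\<lambda>i. density (M i) (f i)"
    using D by (simp add: product_sigma_finite_def)
  note [measurable] = f
  show ?thesis
  proof (rule D.PiM_eqI[OF I, symmetric])
    fix A assume "\<And>i. i \<in> I \<Longrightarrow> A i \<in> sets (density (M i) (f i))"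
    then have A [measurable]: "i \<in> I \<Longrightarrow> A i \<in> sets (M i)" for i by simp
    have "emeasure (density (PiM I M) (\<lambda>x. \<Prod>i\<in>I. f i (x i))) (Pi\<^sub>E I A)
        = (\<integral>\<^sup>+x. (\<Prod>i\<in>I. f i (x i)) * indicator (Pi\<^sub>E I A) x \<partial>PiM I M)"
      using I by (intro emeasure_density) (auto intro!: sets_PiM_I_finite A)
    also have "\<dots> = (\<integral>\<^sup>+x. (\<Prod>i\<in>I. f i (x i) * indicator (A i) (x i)) \<partial>PiM I M)"
      using I by (intro nn_integral_cong)
        (auto simp: prod.distrib indicator_def space_PiM PiE_iff prod_zero_iff)
    also have "\<dots> = (\<Prod>i\<in>I. \<integral>\<^sup>+t. f i t * indicator (A i) t \<partial>M i)"
      using I by (intro M.product_nn_integral_prod) auto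
    also have "\<dots> = (\<Prod>i\<in>I. emeasure (density (M i) (f i)) (A i))"
      by (intro prod.cong) (auto simp: emeasure_density)
    finally show "emeasure (density (PiM I M) (\<lambda>x. \<Prod>i\<in>I. f i (x i))) (Pi\<^sub>E I A)
        = (\<Prod>i\<in>I. emeasure (density (M i) (f i)) (A i))" .
  qed (simp cong: sets_PiM_cong)
qed

text \<open>
  Homogeneity of Lebesgue measure on the real functions on a finite set \<open>I\<close>; it is what
  contributes the power \<open>s ^ (n - 1)\<close> in polar coordinates on the simplex.
\<close>

lemma nn_integral_PiM_lborel_scale:
  fixes s :: real
  assumes I: "finite I" and s: "s > 0" and G: "G \<in> borel_measurable (PiM I (\<lambda>_. lborel))"
  shows "(\<integral>\<^sup>+x. G x \<partial>PiM I (\<lambda>_. lborel))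
      = ennreal (s ^ card I) * (\<integral>\<^sup>+x. G (\<lambda>i\<in>I. s * x i) \<partial>PiM I (\<lambda>_. lborel))"
proof -
  let ?L = "PiM I (\<lambda>_. lborel :: real measure)"
  let ?D = "distr lborel lborel ((*) s)"
  have D: "?D = density lborel (\<lambda>_. inverse \<bar>s\<bar>)"
    using s lborel_distr_mult[of s] distr_cong[OF refl sets_lborel refl, of lborel "(*) s"] by simp
  have sf: "sigma_finite_measure ?D"
    unfolding D by (subst sigma_finite_measure.sigma_finite_iff_density_finite[OF sigma_finite_lborel]) auto
  have "density (distr ?L ?L (\<lambda>x. \<lambda>i\<in>I. s * x i)) (\<lambda>_. ennreal (s ^ card I)) = ?L"
  proof -
    have "distr ?L ?L (\<lambda>x. \<lambda>i\<in>I. s * x i) = PiM I (\<lambda>_. ?D)"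
      using I sf by (intro distr_PiM_coordinatewise) (auto intro: sigma_finite_lborel)
    also have "\<dots> = density ?L (\<lambda>x. \<Prod>i\<in>I. ennreal (inverse \<bar>s\<bar>))"
      unfolding D using sf by (intro PiM_density[OF I]) (auto intro: sigma_finite_lborel simp flip: D)
    finally have "density (distr ?L ?L (\<lambda>x. \<lambda>i\<in>I. s * x i)) (\<lambda>_. ennreal (s ^ card I))
        = density ?L (\<lambda>_. ennreal (s ^ card I) * ennreal (inverse \<bar>s\<bar>) ^ card I)"
      by (simp add: density_density_eq mult.commute)
    also have "ennreal (s ^ card I) * ennreal (inverse \<bar>s\<bar>) ^ card I = 1"
      using s by (simp add: ennreal_power flip: ennreal_mult power_mult_distrib)
    finally show ?thesis unfolding density_1 .
  qed
  then have "(\<integral>\<^sup>+x. G x \<partial>?L) = (\<integral>\<^sup>+x. G x \<partial>density (distr ?L ?L (\<lambda>x. \<lambda>i\<in>I. s * x i)) (\<lambda>_. ennreal (s ^ card I)))"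
    by simp
  also have "\<dots> = ennreal (s ^ card I) * (\<integral>\<^sup>+x. G x \<partial>distr ?L ?L (\<lambda>x. \<lambda>i\<in>I. s * x i))"
    using G by (subst nn_integral_density) (auto simp: nn_integral_cmult)
  also have "(\<integral>\<^sup>+x. G x \<partial>distr ?L ?L (\<lambda>x. \<lambda>i\<in>I. s * x i)) = (\<integral>\<^sup>+x. G (\<lambda>i\<in>I. s * x i) \<partial>?L)"
    using G by (intro nn_integral_distr) auto
  finally show ?thesis .
qed

lemma prod_Basis_vec:
  fixes g :: "'a::euclidean_space ^ 'n \<Rightarrow> 'b::comm_monoid_mult"
  shows "prod g Basis = (\<Prod>j\<in>UNIV. \<Prod>b\<in>Basis. g (axis j b))"
proof -
  have "bij_betw (\<lambda>(j, b). axis j b) (UNIV \<times> Basis) (Basis :: ('a ^ 'n) set)"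
    unfolding bij_betw_def
  proof
    show "inj_on (\<lambda>(j, b). axis j b) (UNIV \<times> (Basis :: 'a set))"
      by (auto simp: inj_on_def axis_eq_axis)
    show "(\<lambda>(j, b). axis j b) ` (UNIV \<times> Basis) = (Basis :: ('a ^ 'n) set)"
      by (auto simp: Basis_vec_def image_iff)
  qed
  then have "prod g Basis = (\<Prod>p\<in>UNIV \<times> Basis. g (case p of (j, b) \<Rightarrow> axis j b))"
    by (intro prod.reindex_bij_betw[symmetric])
  also have "\<dots> = (\<Prod>j\<in>UNIV. \<Prod>b\<in>Basis. g (axis j b))"
    by (subst prod.cartesian_product) (simp add: case_prod_beta')
  finally show ?thesis .
qed

lemma measurable_vec_lambda:
  fixes f :: "'x \<Rightarrow> 'n::finite \<Rightarrow> 'a::euclidean_space"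
  assumes [measurable]: "\<And>j. (\<lambda>x. f x j) \<in> borel_measurable M"
  shows "(\<lambda>x. \<chi> j. f x j) \<in> borel_measurable M"
proof (subst borel_measurable_euclidean_space, intro ballI)
  fix i :: "'a ^ 'n" assume "i \<in> Basis"
  then obtain j b where i: "i = axis j b" by (auto simp: Basis_vec_def)
  show "(\<lambda>x. (\<chi> j. f x j) \<bullet> i) \<in> borel_measurable M"
    unfolding i inner_axis by simp
qed

text \<open>
  The function \<open>\<psi>\<close> numbers the coordinates. It allows the index set to be a set of numbers instead of the
  type \<open>'n\<close>, so that the coordinates of a Gaussian vector can be compared with functions on \<open>{1..n}\<close>.
\<close>

lemma lborel_vec_eq_distr_PiM:
  fixes \<psi> :: "'n::finite \<Rightarrow> 'i"
  assumes \<psi>: "bij_betw \<psi> UNIV I"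
  shows "distr (PiM I (\<lambda>_. lborel)) borel (\<lambda>x. \<chi> j. x (\<psi> j)) = (lborel :: ('a::euclidean_space ^ 'n) measure)"
proof (rule lborel_eqI[symmetric])
  interpret product_sigma_finite "\<lambda>_::'i. lborel :: 'a measure"
    by (simp add: product_sigma_finite_def sigma_finite_lborel)
  have I: "finite I" using bij_betw_finite[OF \<psi>] by simp
  have \<psi>_in: "\<psi> j \<in> I" for j using \<psi> by (auto simp: bij_betw_def)
  have meas: "(\<lambda>x. \<chi> j. x (\<psi> j) :: 'a ^ 'n) \<in> borel_measurable (PiM I (\<lambda>_. lborel))"
    using measurable_component_singleton[OF \<psi>_in, where M = "\<lambda>_. lborel"]
    by (intro measurable_vec_lambda) simp
  fix l u :: "'a ^ 'n" assume lu: "\<And>b. b \<in> Basis \<Longrightarrow> l \<bullet> b \<le> u \<bullet> b"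
  define \<phi> where "\<phi> = inv_into UNIV \<psi>"
  have \<phi>: "\<phi> (\<psi> j) = j" for j using \<psi> by (simp add: \<phi>_def bij_betw_def)
  have \<psi>\<phi>: "\<psi> (\<phi> i) = i" if "i \<in> I" for i using \<psi> that by (simp add: \<phi>_def bij_betw_def f_inv_into_f)
  have le: "l $ j \<bullet> b \<le> u $ j \<bullet> b" if "b \<in> Basis" for j b
    using lu[of "axis j b"] that by (auto simp: Basis_vec_def inner_axis)
  have box_iff: "v \<in> box l u \<longleftrightarrow> (\<forall>j. v $ j \<in> box (l $ j) (u $ j))" for v
    by (auto simp: mem_box Basis_vec_def inner_axis)
  have "(\<lambda>x. \<chi> j. x (\<psi> j)) -` box l u \<inter> space (PiM I (\<lambda>_. lborel)) = Pi\<^sub>E I (\<lambda>i. box (l $ \<phi> i) (u $ \<phi> i))"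
    by (auto simp: box_iff space_PiM PiE_iff \<phi> \<psi>_in) (metis \<phi> \<psi>_in \<psi>\<phi>)+
  then have "emeasure (distr (PiM I (\<lambda>_. lborel)) borel (\<lambda>x. \<chi> j. x (\<psi> j))) (box l u)
      = (\<Prod>i\<in>I. emeasure lborel (box (l $ \<phi> i) (u $ \<phi> i)))"
    using I by (subst emeasure_distr) (auto intro!: meas emeasure_PiM)
  also have "\<dots> = (\<Prod>j\<in>UNIV. emeasure lborel (box (l $ j) (u $ j)))"
    using \<psi> by (subst prod.reindex_bij_betw[symmetric, OF \<psi>]) (simp add: \<phi>)
  also have "\<dots> = (\<Prod>j\<in>UNIV. ennreal (\<Prod>b\<in>Basis. (u $ j - l $ j) \<bullet> b))"
    using le by (intro prod.cong) auto
  also have "\<dots> = ennreal (\<Prod>b\<in>Basis. (u - l) \<bullet> b)"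
    using le by (subst prod_ennreal) (auto simp: prod_Basis_vec inner_axis inner_diff_left intro!: prod_nonneg)
  finally show "emeasure (distr (PiM I (\<lambda>_. lborel)) borel (\<lambda>x. \<chi> j. x (\<psi> j))) (box l u)
      = (\<Prod>b\<in>Basis. (u - l) \<bullet> b)" .
qed simp

section \<open>Normalised exponential variables\<close>

(* This keeps the index sets in the form {1..n}, so that the facts about them apply. *)
declare One_nat_def [simp del]

definition normalize_sum :: "'i set \<Rightarrow> ('i \<Rightarrow> real) \<Rightarrow> 'i \<Rightarrow> real" where
  "normalize_sum I y = (\<lambda>i\<in>I. y i / (\<Sum>j\<in>I. y j))"

lemma measurable_normalize_sum [measurable]:
  assumes M: "\<And>i. sets (M i) = sets borel"
  shows "normalize_sum I \<in> measurable (PiM I M) (PiM I (\<lambda>_. borel))"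
proof -
  note [measurable_cong] = M
  show ?thesis unfolding normalize_sum_def by measurable
qed

text \<open>
  The map along which \<open>simplex_measure\<close> pushes Lebesgue measure forward, and the region of
  integration. Naming them separates the computations in the first \<open>n - 1\<close> coordinates from the
  measure on \<open>n\<close> of them.
\<close>

definition simplex_point :: "nat \<Rightarrow> (nat \<Rightarrow> real) \<Rightarrow> nat \<Rightarrow> real" where
  "simplex_point n x = x(n := 1 - (\<Sum>i\<in>{1..<n}. x i))"

definition simplex_region :: "nat \<Rightarrow> (nat \<Rightarrow> real) set" where
  "simplex_region n = {x. (\<forall>i\<in>{1..<n}. 0 \<le> x i) \<and> (\<Sum>i\<in>{1..<n}. x i) \<le> 1}"

lemma insert_n: "n \<ge> 1 \<Longrightarrow> insert n {1..<n} = {1..n::nat}"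
  by auto

lemma sets_simplex_measure: "sets (simplex_measure n) = sets (PiM {1..n} (\<lambda>_. borel))"
  by (simp add: simplex_measure_def)

lemma sum_simplex_point:
  assumes "n \<ge> 1"
  shows "(\<Sum>i\<in>{1..n}. simplex_point n x i) = 1"
proof -
  have "(\<Sum>i\<in>{1..n}. simplex_point n x i) = simplex_point n x n + (\<Sum>i\<in>{1..<n}. simplex_point n x i)"
    using assms by (simp flip: insert_n)
  also have "(\<Sum>i\<in>{1..<n}. simplex_point n x i) = (\<Sum>i\<in>{1..<n}. x i)"
    by (intro sum.cong) (auto simp: simplex_point_def)
  finally show ?thesis by (simp add: simplex_point_def)
qed

lemma simplex_region_iff:
  assumes "n \<ge> 1"
  shows "x \<in> simplex_region n \<longleftrightarrow> (\<forall>i\<in>{1..n}. 0 \<le> simplex_point n x i)"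
  using assms by (auto simp: simplex_region_def simplex_point_def simp flip: insert_n)

lemma linear_form_simplex_point_pos:
  assumes n: "n \<ge> 1" and b: "\<And>i. b i > (0::real)" and x: "x \<in> simplex_region n"
  shows "(\<Sum>i\<in>{1..n}. simplex_point n x i * b i) > 0"
proof -
  have nonneg: "0 \<le> simplex_point n x i" if "i \<in> {1..n}" for i
    using x that simplex_region_iff[OF n] by blast
  have "\<exists>i\<in>{1..n}. simplex_point n x i \<noteq> 0"
    using sum_simplex_point[OF n, of x] by (metis sum.neutral zero_neq_one)
  then obtain i where i: "i \<in> {1..n}" "simplex_point n x i > 0"
    using nonneg by (metis less_eq_real_def)
  show ?thesis
    using i b nonneg by (intro sum_pos2[of _ i]) (auto intro: mult_nonneg_nonneg less_imp_le)
qed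

lemma measurable_simplex_point:
  assumes "n \<ge> 1"
  shows "simplex_point n \<in> measurable (PiM {1..<n} (\<lambda>_. lborel)) (PiM {1..n} (\<lambda>_. borel))"
  unfolding simplex_point_def
proof (rule measurable_fun_upd[where J = "{1..<n}"])
  show "{1..n} = {1..<n} \<union> {n}" using insert_n[OF assms] by auto
  show "(\<lambda>x. x) \<in> measurable (PiM {1..<n} (\<lambda>_. lborel)) (PiM {1..<n} (\<lambda>_. borel :: real measure))"
    by (rule measurable_ident_sets) (simp cong: sets_PiM_cong)
qed measurable

lemma simplex_region_sets [measurable]:
  "simplex_region n \<inter> space (PiM {1..<n} (\<lambda>_. lborel)) \<in> sets (PiM {1..<n} (\<lambda>_. lborel))"
proof -
  have "{x \<in> space (PiM {1..<n} (\<lambda>_. lborel)). (\<forall>i\<in>{1..<n}. 0 \<le> x i) \<and> (\<Sum>i\<in>{1..<n}. x i) \<le> (1::real)}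
      \<in> sets (PiM {1..<n} (\<lambda>_. lborel))"
    by measurable
  also have "{x \<in> space (PiM {1..<n} (\<lambda>_. lborel)). (\<forall>i\<in>{1..<n}. 0 \<le> x i) \<and> (\<Sum>i\<in>{1..<n}. x i) \<le> (1::real)}
      = simplex_region n \<inter> space (PiM {1..<n} (\<lambda>_. lborel))"
    by (auto simp: simplex_region_def)
  finally show ?thesis .
qed

lemma measurable_indicator_simplex_region [measurable]:
  "(indicator (simplex_region n) :: _ \<Rightarrow> ennreal) \<in> borel_measurable (PiM {1..<n} (\<lambda>_. lborel))"
  by (subst borel_measurable_indicator_iff) (simp add: simplex_region_sets)

lemma nn_integral_simplex_measure:
  assumes n: "n \<ge> 1" and F [measurable]: "F \<in> borel_measurable (PiM {1..n} (\<lambda>_. borel))"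
  shows "(\<integral>\<^sup>+p. F p \<partial>simplex_measure n)
      = (\<integral>\<^sup>+x. indicator (simplex_region n) x * F (simplex_point n x) \<partial>PiM {1..<n} (\<lambda>_. lborel))"
proof -
  note [measurable] = measurable_simplex_point[OF n]
  have "simplex_measure n = distr (density (PiM {1..<n} (\<lambda>_. lborel)) (indicator (simplex_region n)))
      (PiM {1..n} (\<lambda>_. borel)) (simplex_point n)"
    unfolding simplex_measure_def simplex_region_def simplex_point_def ..
  then show ?thesis
    by (simp add: nn_integral_distr nn_integral_density)
qed

text \<open>
  The gamma integral, read off from the fact that the Erlang density has total mass one.
\<close>

lemma nn_integral_gamma:
  fixes L :: real
  assumes L: "L > 0"
  shows "(\<integral>\<^sup>+s. indicator {0<..} s * ennreal (s ^ k * exp (- s * L)) \<partial>lborel) = ennreal (fact k / L ^ Suc k)"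
proof -
  have "(\<integral>\<^sup>+s. indicator {0<..} s * ennreal (s ^ k * exp (- s * L)) \<partial>lborel)
      = (\<integral>\<^sup>+s. ennreal (fact k / L ^ Suc k) * ennreal (erlang_density k L s) \<partial>lborel)"
  proof (rule nn_integral_cong_AE)
    have "AE s in lborel. s \<noteq> (0::real)" by (rule AE_lborel_singleton)
    then show "AE s in lborel. indicator {0<..} s * ennreal (s ^ k * exp (- s * L))
        = ennreal (fact k / L ^ Suc k) * ennreal (erlang_density k L s)"
    proof eventually_elim
      case (elim s)
      then show ?case
        using L by (auto simp: indicator_def erlang_density_def field_simps simp flip: ennreal_mult)
    qed
  qed
  also have "\<dots> = ennreal (fact k / L ^ Suc k) * (\<integral>\<^sup>+s. ennreal (erlang_density k L s) \<partial>lborel)"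
    by (rule nn_integral_cmult) simp
  also have "(\<integral>\<^sup>+s. ennreal (erlang_density k L s) \<partial>lborel) = 1"
    using prob_space.emeasure_space_1[OF prob_space_erlang_density[OF L, of k]]
    by (simp add: emeasure_density)
  finally show ?thesis by simp
qed

text \<open>
  The variables \<open>y\<^sub>1, \<dots>, y\<^sub>n\<close> are replaced by their sum \<open>s\<close> and the normalised values \<open>p\<close>.
  For fixed \<open>y\<^sub>1, \<dots>, y\<^sub>n\<^sub>-\<^sub>1\<close>, passing from \<open>y\<^sub>n\<close> to \<open>s\<close> is a translation; for fixed \<open>s\<close>, passing from
  \<open>y\<^sub>1, \<dots>, y\<^sub>n\<^sub>-\<^sub>1\<close> to \<open>p\<^sub>1, \<dots>, p\<^sub>n\<^sub>-\<^sub>1\<close> is a scaling and gives the factor \<open>s ^ (n - 1)\<close>. So no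
  multidimensional change of variables is involved. The joint density
  of the \<open>y\<^sub>i\<close> becomes \<open>(\<Prod>i. b\<^sub>i) * exp (- s * (\<Sum>i. p\<^sub>i * b\<^sub>i))\<close> on the simplex, and
  integrating \<open>s\<close> out is a gamma integral.
\<close>

lemma distr_normalized_exponentials:
  fixes b :: "nat \<Rightarrow> real"
  assumes n: "n \<ge> 1" and b: "\<And>i. b i > 0"
  shows "distr (PiM {1..n} (\<lambda>i. density lborel (exponential_density (b i)))) (PiM {1..n} (\<lambda>_. borel))
           (normalize_sum {1..n})
       = density (simplex_measure n)
           (\<lambda>p. ennreal (fact (n - 1) * (\<Prod>i=1..n. b i) / (\<Sum>i=1..n. p i * b i) ^ n))"
    (is "distr ?E ?B _ = density _ ?f")
proof (rule measure_eqI)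
  show "sets (distr ?E ?B (normalize_sum {1..n})) = sets (density (simplex_measure n) ?f)"
    by (simp add: sets_simplex_measure)
  fix A assume "A \<in> sets (distr ?E ?B (normalize_sum {1..n}))"
  then have A [measurable]: "A \<in> sets ?B" by simp
  define F :: "(nat \<Rightarrow> real) \<Rightarrow> ennreal" where "F = indicator A"
  have F [measurable]: "F \<in> borel_measurable ?B" unfolding F_def by simp
  interpret product_sigma_finite "\<lambda>_::nat. lborel :: real measure"
    by (simp add: product_sigma_finite_def sigma_finite_lborel)
  interpret I: finite_product_sigma_finite "\<lambda>_::nat. lborel :: real measure" "{1..<n}"
    by standard simp
  let ?I = "PiM {1..<n} (\<lambda>_. lborel :: real measure)"
  interpret P: pair_sigma_finite ?I "lborel :: real measure" ..
  \<comment> \<open>The integrand at \<open>y = s * p\<close>, without the factor \<open>s ^ (n - 1)\<close> of the scaling.\<close>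
  let ?K = "\<lambda>x s. indicator (simplex_region n) x * F (simplex_point n x)
    * ennreal ((\<Prod>i\<in>{1..n}. b i) * exp (- s * (\<Sum>i\<in>{1..n}. simplex_point n x i * b i)))"
  define D where "D y = (\<Prod>i\<in>{1..n}. ennreal (exponential_density (b i) (y i)))" for y :: "nat \<Rightarrow> real"
  define S where "S x = (\<Sum>i\<in>{1..<n}. x i)" for x :: "nat \<Rightarrow> real"
  \<comment> \<open>The integrand in the variables \<open>y\<^sub>1, \<dots>, y\<^sub>n\<^sub>-\<^sub>1\<close> and \<open>s\<close>.\<close>
  define G where "G x s = F (normalize_sum {1..n} (x(n := s - S x))) * D (x(n := s - S x))" for x s
  note [measurable] = measurable_simplex_point[OF n]
  have E: "?E = density (PiM {1..n} (\<lambda>_. lborel)) D"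
    unfolding D_def using b
    by (intro PiM_density) (auto intro!: sigma_finite_lborel
        prob_space_imp_sigma_finite prob_space_erlang_density)
  have D_meas [measurable]: "D \<in> borel_measurable (PiM {1..n} (\<lambda>_. lborel))"
    unfolding D_def by measurable
  have FN_meas [measurable]: "(\<lambda>y. F (normalize_sum {1..n} y)) \<in> borel_measurable (PiM {1..n} (\<lambda>_. lborel))"
    by (rule measurable_compose[OF measurable_normalize_sum F]) simp
  have upd: "(\<lambda>p. (fst p)(n := snd p - S (fst p)))
      \<in> measurable (?I \<Otimes>\<^sub>M lborel) (PiM {1..n} (\<lambda>_. lborel))"
    by (rule measurable_fun_upd[where J = "{1..<n}"]) (auto simp: S_def insert_n[OF n, symmetric])
  have G_meas [measurable]: "case_prod G \<in> borel_measurable (?I \<Otimes>\<^sub>M lborel)"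
    unfolding G_def case_prod_beta'
    using measurable_compose[OF upd FN_meas] measurable_compose[OF upd D_meas]
    by (rule borel_measurable_times_ennreal)
  have "emeasure (distr ?E ?B (normalize_sum {1..n})) A = (\<integral>\<^sup>+p. F p \<partial>distr ?E ?B (normalize_sum {1..n}))"
    by (simp add: F_def)
  also have "\<dots> = (\<integral>\<^sup>+y. F (normalize_sum {1..n} y) \<partial>?E)"
    by (rule nn_integral_distr) simp_all
  also have "\<dots> = (\<integral>\<^sup>+y. D y * F (normalize_sum {1..n} y) \<partial>PiM {1..n} (\<lambda>_. lborel))"
    unfolding E by (rule nn_integral_density) simp_all
  also have "\<dots> = (\<integral>\<^sup>+x. (\<integral>\<^sup>+t. D (x(n := t)) * F (normalize_sum {1..n} (x(n := t))) \<partial>lborel) \<partial>?I)"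
    using n product_nn_integral_insert[of "{1..<n}" n "\<lambda>y. D y * F (normalize_sum {1..n} y)"]
    unfolding insert_n[OF n] by simp
  also have "\<dots> = (\<integral>\<^sup>+x. (\<integral>\<^sup>+s. G x s \<partial>lborel) \<partial>?I)"
  proof (rule nn_integral_cong)
    fix x assume x: "x \<in> space ?I"
    have "(\<lambda>t. D (x(n := t)) * F (normalize_sum {1..n} (x(n := t)))) \<in> borel_measurable borel"
    proof -
      have "(\<lambda>t. x(n := t)) \<in> measurable borel (PiM {1..n} (\<lambda>_. lborel))"
        using x by (intro measurable_fun_upd[where J = "{1..<n}"]) (auto simp: insert_n[OF n, symmetric])
      then show ?thesis by measurable
    qed
    from nn_integral_real_affine[OF this, of 1 "- S x"]
    show "(\<integral>\<^sup>+t. D (x(n := t)) * F (normalize_sum {1..n} (x(n := t))) \<partial>lborel) = (\<integral>\<^sup>+s. G x s \<partial>lborel)"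
      by (simp add: G_def mult.commute)
  qed
  also have "\<dots> = (\<integral>\<^sup>+s. (\<integral>\<^sup>+x. G x s \<partial>?I) \<partial>lborel)"
    by (rule P.Fubini'[symmetric]) measurable
  also have "\<dots> = (\<integral>\<^sup>+s. (\<integral>\<^sup>+x. indicator {0<..} s * ennreal (s ^ (n - 1)) * ?K x s \<partial>?I) \<partial>lborel)"
  proof (rule nn_integral_cong_AE)
    have "AE s in lborel. s \<noteq> (0::real)" by (rule AE_lborel_singleton)
    then show "AE s in lborel. (\<integral>\<^sup>+x. G x s \<partial>?I) = (\<integral>\<^sup>+x. indicator {0<..} s * ennreal (s ^ (n - 1)) * ?K x s \<partial>?I)"
    proof eventually_elim
      case (elim s)
      show ?case
      proof (cases "s > 0")
        case False
        \<comment> \<open>A negative sum has a negative summand, and the exponential density vanishes there.\<close>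
        have "D (x(n := s - S x)) = 0" for x
        proof -
          have "(\<Sum>i\<in>{1..n}. (x(n := s - S x)) i) = s"
            using n by (simp flip: insert_n) (simp add: S_def cong: sum.cong_simp)
          moreover have "s < 0" using False elim by linarith
          ultimately have "\<not> (\<forall>i\<in>{1..n}. 0 \<le> (x(n := s - S x)) i)"
            using sum_nonneg[of "{1..n}" "x(n := s - S x)"] by fastforce
          then obtain i where i: "i \<in> {1..n}" "(x(n := s - S x)) i < 0"
            by (meson not_le)
          then show ?thesis unfolding D_def
            by (intro prod_zero) (auto intro!: bexI[of _ i] simp: erlang_density_def)
        qed
        then show ?thesis using False by (simp add: G_def)
      next
        case True
        have "(\<integral>\<^sup>+x. G x s \<partial>?I) = ennreal (s ^ (n - 1)) * (\<integral>\<^sup>+x. G (\<lambda>i\<in>{1..<n}. s * x i) s \<partial>?I)"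
          by (subst nn_integral_PiM_lborel_scale[OF _ True]) simp_all
        also have "(\<integral>\<^sup>+x. G (\<lambda>i\<in>{1..<n}. s * x i) s \<partial>?I) = (\<integral>\<^sup>+x. ?K x s \<partial>?I)"
        proof (rule nn_integral_cong)
          fix x assume x: "x \<in> space ?I"
          let ?y = "(\<lambda>i\<in>{1..<n}. s * x i)(n := s - S (\<lambda>i\<in>{1..<n}. s * x i))"
          have y: "?y i = s * simplex_point n x i" if "i \<in> {1..n}" for i
            using that by (auto simp: S_def simplex_point_def sum_distrib_left right_diff_distrib)
          have "(\<Sum>i\<in>{1..n}. ?y i) = (\<Sum>i\<in>{1..n}. s * simplex_point n x i)"
            by (intro sum.cong y refl)
          then have "(\<Sum>i\<in>{1..n}. ?y i) = s"
            by (simp add: sum_simplex_point[OF n] flip: sum_distrib_left)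
          moreover have "simplex_point n x i = undefined" if "i \<notin> {1..n}" for i
            using x that n by (auto simp: simplex_point_def space_PiM PiE_iff extensional_def)
          ultimately have norm: "normalize_sum {1..n} ?y = simplex_point n x"
            using True y by (auto simp: normalize_sum_def fun_eq_iff)
          have "D ?y = (\<Prod>i\<in>{1..n}. ennreal (exponential_density (b i) (s * simplex_point n x i)))"
            unfolding D_def by (intro prod.cong) (simp_all only: y)
          also have "\<dots> = indicator (simplex_region n) x * ennreal ((\<Prod>i\<in>{1..n}. b i) * exp (- s * (\<Sum>i\<in>{1..n}. simplex_point n x i * b i)))"
          proof (cases "x \<in> simplex_region n")
            case xR: True
            have "(\<Prod>i\<in>{1..n}. ennreal (exponential_density (b i) (s * simplex_point n x i)))
                = (\<Prod>i\<in>{1..n}. ennreal (b i * exp (- s * (simplex_point n x i * b i))))"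
            proof (intro prod.cong refl)
              fix i assume "i \<in> {1..n}"
              then have "0 \<le> s * simplex_point n x i" using xR True simplex_region_iff[OF n] by simp
              then show "ennreal (exponential_density (b i) (s * simplex_point n x i)) = ennreal (b i * exp (- s * (simplex_point n x i * b i)))"
                by (simp add: erlang_density_def mult_ac)
            qed
            also have "\<dots> = ennreal (\<Prod>i\<in>{1..n}. b i * exp (- s * (simplex_point n x i * b i)))"
              using b by (intro prod_ennreal) (simp add: less_imp_le)
            finally show ?thesis
              using xR by (simp add: prod.distrib exp_sum sum_distrib_left sum_negf[symmetric])
          next
            case False
            then obtain i where "i \<in> {1..n}" "simplex_point n x i < 0"
              using simplex_region_iff[OF n] by (meson not_le)
            then have "(\<Prod>i\<in>{1..n}. ennreal (exponential_density (b i) (s * simplex_point n x i))) = 0"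
              using True by (intro prod_zero) (auto intro!: bexI[of _ i] simp: erlang_density_def mult_less_0_iff)
            then show ?thesis using False by simp
          qed
          finally show "G (\<lambda>i\<in>{1..<n}. s * x i) s = ?K x s"
            unfolding G_def norm by (simp add: mult_ac)
        qed
        also have "ennreal (s ^ (n - 1)) * \<dots> = (\<integral>\<^sup>+x. ennreal (s ^ (n - 1)) * ?K x s \<partial>?I)"
          by (rule nn_integral_cmult[symmetric]) measurable
        finally show ?thesis using True by simp
      qed
    qed
  qed
  also have "\<dots> = (\<integral>\<^sup>+x. (\<integral>\<^sup>+s. indicator {0<..} s * ennreal (s ^ (n - 1)) * ?K x s \<partial>lborel) \<partial>?I)"
    by (rule P.Fubini') measurable
  also have "\<dots> = (\<integral>\<^sup>+x. indicator (simplex_region n) x * (?f (simplex_point n x) * F (simplex_point n x)) \<partial>?I)"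
  proof (rule nn_integral_cong)
    fix x
    let ?L = "\<Sum>i\<in>{1..n}. simplex_point n x i * b i"
    show "(\<integral>\<^sup>+s. indicator {0<..} s * ennreal (s ^ (n - 1)) * ?K x s \<partial>lborel)
      = indicator (simplex_region n) x * (?f (simplex_point n x) * F (simplex_point n x))"
    proof (cases "x \<in> simplex_region n")
      case True
      have L: "?L > 0" using linear_form_simplex_point_pos[OF n b True] .
      have pb: "(\<Prod>i\<in>{1..n}. b i) > 0" using b by (intro prod_pos) auto
      have "(\<integral>\<^sup>+s. indicator {0<..} s * ennreal (s ^ (n - 1)) * ?K x s \<partial>lborel)
        = (\<integral>\<^sup>+s. (F (simplex_point n x) * ennreal (\<Prod>i\<in>{1..n}. b i)) *
            (indicator {0<..} s * ennreal (s ^ (n - 1) * exp (- s * ?L))) \<partial>lborel)"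
        using True pb by (intro nn_integral_cong)
          (auto simp: indicator_def ennreal_mult' mult_ac)
      also have "\<dots> = (F (simplex_point n x) * ennreal (\<Prod>i\<in>{1..n}. b i)) * ennreal (fact (n - 1) / ?L ^ Suc (n - 1))"
        by (subst nn_integral_cmult) (simp_all only: nn_integral_gamma[OF L], measurable)
      also have "\<dots> = ?f (simplex_point n x) * F (simplex_point n x)"
        using n pb L by (simp add: mult_ac flip: ennreal_mult')
      finally show ?thesis using True by simp
    qed simp
  qed
  also have "\<dots> = (\<integral>\<^sup>+p. ?f p * F p \<partial>simplex_measure n)"
    by (rule nn_integral_simplex_measure[OF n, symmetric]) measurable
  also have "\<dots> = emeasure (density (simplex_measure n) ?f) A"
    by (subst emeasure_density) (auto simp: F_def sets_simplex_measure cong: measurable_cong_sets)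
  finally show "emeasure (distr ?E ?B (normalize_sum {1..n})) A = emeasure (density (simplex_measure n) ?f) A" .
qed

section \<open>Gaussian vectors and their directions\<close>

text \<open>
  For \<open>a \<ge> 0\<close> the set where \<open>c * (cmod z)\<^sup>2 \<le> a\<close> is a disc of radius \<open>sqrt (a / c)\<close>; its area
  \<open>pi * a / c\<close> is linear in \<open>a\<close>, so planar Lebesgue measure has an image of constant density on the
  half-line.
\<close>

lemma distr_lborel_scaled_norm_sq:
  assumes c: "c > 0"
  shows "distr lborel borel (\<lambda>z::complex. c * (cmod z)\<^sup>2) = density lborel (\<lambda>t. ennreal (pi / c) * indicator {0..} t)"
    (is "?L = ?R")
proof (rule measure_eqI_generator_eq[where E = "range atMost" and \<Omega> = UNIV and A = "\<lambda>m. {..real m}"])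
  have L: "emeasure ?L {..a} = ennreal (pi / c * max 0 a)" for a
  proof -
    have "(\<lambda>z::complex. c * (cmod z)\<^sup>2) -` {..a} = (if a \<ge> 0 then cball 0 (sqrt (a / c)) else {})"
    proof (cases "a \<ge> 0")
      case True
      have "c * (cmod z)\<^sup>2 \<le> a \<longleftrightarrow> cmod z \<le> sqrt (a / c)" for z
        using c True by (metis mult.commute norm_ge_zero pos_le_divide_eq real_le_rsqrt real_sqrt_le_iff real_sqrt_abs abs_norm_cancel)
      then show ?thesis using True by auto
    next
      case False
      then have "\<not> c * (cmod z)\<^sup>2 \<le> a" for z
        using c by (meson mult_nonneg_nonneg less_imp_le order_trans zero_le_power2)
      then show ?thesis using False by auto
    qed
    then show ?thesis
      using c by (simp add: emeasure_distr emeasure_cball unit_ball_vol_2 mult.commute)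
  qed
  show "emeasure ?L X = emeasure ?R X" if "X \<in> range atMost" for X
  proof -
    obtain a where X: "X = {..a}" using \<open>X \<in> range atMost\<close> by auto
    have "emeasure ?R X = (\<integral>\<^sup>+t. ennreal (pi / c) * indicator {0..max 0 a} t * indicator X t \<partial>lborel)"
      unfolding X by (subst emeasure_density) (auto intro!: nn_integral_cong simp: indicator_def)
    also have "\<dots> = (\<integral>\<^sup>+t. ennreal (pi / c) * indicator (if a \<ge> 0 then {0..a} else {}) t \<partial>lborel)"
      unfolding X by (intro nn_integral_cong) (auto simp: indicator_def)
    also have "\<dots> = ennreal (pi / c) * ennreal (max 0 a)"
      by (subst nn_integral_cmult_indicator) (auto simp: ennreal_neg)
    also have "\<dots> = emeasure ?L X"
      unfolding X L using c by (intro ennreal_mult[symmetric]) auto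
    finally show ?thesis by simp
  qed
  show "sets ?L = sigma_sets UNIV (range atMost)" "sets ?R = sigma_sets UNIV (range atMost)"
    by (simp_all add: borel_eq_atMost)
  show "(\<Union>m. {..real m}) = UNIV"
    using real_arch_simple by auto
  show "emeasure ?L {..real m} \<noteq> \<infinity>" for m by (simp add: L)
  show "Int_stable (range (atMost :: real \<Rightarrow> _))"
    by (auto simp: Int_stable_def)
qed auto

text \<open>
  The complex normal distribution normalised by mean squared modulus \<open>1\<close>, for which
  \<open>(cmod z)\<^sup>2\<close> is exponential with mean one.
\<close>

definition std_complex_normal :: "complex measure" where
  "std_complex_normal = density lborel (\<lambda>z. ennreal (exp (- (cmod z)\<^sup>2) / pi))"

lemma sets_std_complex_normal [simp, measurable_cong]: "sets std_complex_normal = sets borel"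
  by (simp add: std_complex_normal_def)

lemma distr_std_complex_normal_norm_sq:
  assumes c: "c > 0"
  shows "distr std_complex_normal borel (\<lambda>z. c * (cmod z)\<^sup>2) = density lborel (exponential_density (1 / c))"
proof -
  have "std_complex_normal = density lborel (\<lambda>z. ennreal (exp (- (c * (cmod z)\<^sup>2) / c) / pi))"
    using c by (simp add: std_complex_normal_def)
  then have "distr std_complex_normal borel (\<lambda>z. c * (cmod z)\<^sup>2)
      = density (distr lborel borel (\<lambda>z::complex. c * (cmod z)\<^sup>2)) (\<lambda>t. ennreal (exp (- t / c) / pi))"
    by (subst density_distr) simp_all
  also have "\<dots> = density lborel (\<lambda>t. ennreal (pi / c) * indicator {0..} t * ennreal (exp (- t / c) / pi))"
    unfolding distr_lborel_scaled_norm_sq[OF c] by (rule density_density_eq) simp_all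
  also have "\<dots> = density lborel (exponential_density (1 / c))"
    using c by (intro density_cong)
      (auto simp: indicator_def erlang_density_def mult_ac simp flip: ennreal_mult)
  finally show ?thesis .
qed

lemma prob_space_std_complex_normal: "prob_space std_complex_normal"
proof (rule prob_space_distrD)
  show "(\<lambda>z. 1 * (cmod z)\<^sup>2) \<in> measurable std_complex_normal borel" by simp
  show "prob_space (distr std_complex_normal borel (\<lambda>z. 1 * (cmod z)\<^sup>2))"
    unfolding distr_std_complex_normal_norm_sq[OF zero_less_one] by (simp add: prob_space_erlang_density)
qed

definition complex_gaussian :: "(complex ^ 'n) measure" where
  "complex_gaussian = density lborel (\<lambda>z. \<Prod>j\<in>UNIV. ennreal (exp (- (cmod (z $ j))\<^sup>2) / pi))"

lemma sets_complex_gaussian [simp, measurable_cong]: "sets complex_gaussian = sets borel"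
  by (simp add: complex_gaussian_def)

lemma measurable_vec_nth_complex [measurable]:
  "(\<lambda>z :: complex ^ 'n. z $ j) \<in> borel_measurable borel"
  by (intro borel_measurable_continuous_onI continuous_intros)

lemma complex_gaussian_eq_distr_PiM:
  fixes \<psi> :: "'n::finite \<Rightarrow> 'i"
  assumes \<psi>: "bij_betw \<psi> UNIV I"
  shows "distr (PiM I (\<lambda>_. std_complex_normal)) borel (\<lambda>x. \<chi> j. x (\<psi> j)) = (complex_gaussian :: (complex ^ 'n) measure)"
proof -
  let ?g = "\<lambda>z::complex. ennreal (exp (- (cmod z)\<^sup>2) / pi)"
  have I: "finite I" using bij_betw_finite[OF \<psi>] by simp
  have \<psi>_in: "\<psi> j \<in> I" for j using \<psi> by (auto simp: bij_betw_def)
  have meas: "(\<lambda>x. \<chi> j. x (\<psi> j) :: complex ^ 'n) \<in> borel_measurable (PiM I (\<lambda>_. lborel))"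
    using measurable_component_singleton[OF \<psi>_in, where M = "\<lambda>_. lborel"]
    by (intro measurable_vec_lambda) simp
  have "PiM I (\<lambda>_. std_complex_normal) = density (PiM I (\<lambda>_. lborel)) (\<lambda>x. \<Prod>i\<in>I. ?g (x i))"
    unfolding std_complex_normal_def
    using prob_space_imp_sigma_finite[OF prob_space_std_complex_normal]
    by (intro PiM_density[OF I]) (auto intro: sigma_finite_lborel simp: std_complex_normal_def)
  also have "\<dots> = density (PiM I (\<lambda>_. lborel)) (\<lambda>x. \<Prod>j\<in>UNIV. ?g ((\<chi> j. x (\<psi> j)) $ j))"
    by (simp add: prod.reindex_bij_betw[OF \<psi>, of "\<lambda>i. ?g (_ i)"])
  finally have "distr (PiM I (\<lambda>_. std_complex_normal)) borel (\<lambda>x. \<chi> j. x (\<psi> j))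
      = density (distr (PiM I (\<lambda>_. lborel)) borel (\<lambda>x. \<chi> j. x (\<psi> j) :: complex ^ 'n)) (\<lambda>z. \<Prod>j\<in>UNIV. ?g (z $ j))"
    by (simp only:) (rule density_distr[symmetric, OF _ meas], measurable)
  then show ?thesis
    by (simp only: lborel_vec_eq_distr_PiM[OF \<psi>] complex_gaussian_def)
qed

lemma ex_numbering: "\<exists>\<psi>. bij_betw \<psi> (UNIV :: 'n::finite set) {1..CARD('n)}"
  by (rule finite_same_card_bij) auto

lemma prob_space_complex_gaussian: "prob_space (complex_gaussian :: (complex ^ 'n) measure)"
proof -
  obtain \<psi> where \<psi>: "bij_betw \<psi> (UNIV :: 'n set) {1..CARD('n)}" using ex_numbering by blast
  then have "\<psi> j \<in> {1..CARD('n)}" for j by (auto simp: bij_betw_def)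
  from measurable_component_singleton[OF this, where M = "\<lambda>_. std_complex_normal"]
  have meas: "(\<lambda>x. \<chi> j. x (\<psi> j) :: complex ^ 'n) \<in> borel_measurable (PiM {1..CARD('n)} (\<lambda>_. std_complex_normal))"
    by (intro measurable_vec_lambda) (simp cong: measurable_cong_sets)
  show ?thesis
    unfolding complex_gaussian_eq_distr_PiM[OF \<psi>, symmetric]
    by (intro prob_space.prob_space_distr prob_space_PiM prob_space_std_complex_normal meas)
qed

text \<open>
  The density is a function of \<open>norm z\<close>, which unitary maps preserve together with Lebesgue measure.
\<close>

lemma complex_gaussian_unitary_invariant:
  fixes U :: "complex ^ 'n ^ 'n"
  assumes U: "unitary_mat U"
  shows "distr complex_gaussian borel ((*v) U) = complex_gaussian"
proof -
  define h where "h z = ennreal (exp (- (norm z)\<^sup>2) / pi ^ CARD('n))" for z :: "complex ^ 'n"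
  have "(\<Prod>j\<in>UNIV. ennreal (exp (- (cmod (z $ j))\<^sup>2) / pi)) = h z" for z :: "complex ^ 'n"
  proof -
    have "(norm z)\<^sup>2 = (\<Sum>j\<in>UNIV. (cmod (z $ j))\<^sup>2)"
      by (simp add: norm_vec_def L2_set_def sum_nonneg)
    then show ?thesis
      by (simp add: h_def prod_ennreal prod_dividef exp_sum flip: sum_negf)
  qed
  then have gauss: "complex_gaussian = density lborel h" by (simp add: complex_gaussian_def)
  have [measurable]: "h \<in> borel_measurable borel" unfolding h_def by measurable
  have "distr lborel borel ((*v) U) = lborel"
    by (rule lborel_distr_isometry[where T' = "(*v) (adjoint_mat U)"])
      (simp_all add: dist_unitary[OF U] unitary_adjoint_cancel[OF U])
  then have "density lborel h = density (distr lborel borel ((*v) U)) h" by simp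
  also have "\<dots> = distr (density lborel (\<lambda>z. h (U *v z))) borel ((*v) U)"
    by (rule density_distr) simp_all
  also have "(\<lambda>z. h (U *v z)) = h" by (simp add: h_def norm_unitary[OF U] fun_eq_iff)
  finally show ?thesis by (simp add: gauss)
qed

definition gaussian_direction :: "(complex ^ 'n) measure" where
  "gaussian_direction = distr complex_gaussian borel (\<lambda>z. z /\<^sub>R norm z)"

lemma haar_sphere_gaussian_direction: "haar_sphere (gaussian_direction :: (complex ^ 'n) measure)"
  unfolding haar_sphere_def
proof (intro conjI allI impI)
  interpret prob_space "complex_gaussian :: (complex ^ 'n) measure" by (rule prob_space_complex_gaussian)
  show "prob_space (gaussian_direction :: (complex ^ 'n) measure)"
    unfolding gaussian_direction_def by (rule prob_space_distr) simp
  show "sets (gaussian_direction :: (complex ^ 'n) measure) = sets borel"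
    by (simp add: gaussian_direction_def)
  have "AE z in lborel. z \<noteq> (0 :: complex ^ 'n)" by (rule AE_lborel_singleton)
  then have "AE z in complex_gaussian. z \<noteq> (0 :: complex ^ 'n)"
    unfolding complex_gaussian_def by (subst AE_density) auto
  then have "AE z in complex_gaussian. norm (z /\<^sub>R norm z) = (1::real) \<or> z = (0 :: complex ^ 'n)"
    by eventually_elim simp
  then have "AE z in complex_gaussian. norm (z /\<^sub>R norm z :: complex ^ 'n) = 1"
    using \<open>AE z in complex_gaussian. z \<noteq> 0\<close> by eventually_elim blast
  then show "AE x in gaussian_direction. norm (x :: complex ^ 'n) = 1"
    unfolding gaussian_direction_def by (subst AE_distr_iff) auto
  fix U :: "complex ^ 'n ^ 'n" assume U: "unitary_mat U"
  have scale: "U *v (c *\<^sub>R z) = c *\<^sub>R (U *v z)" for c z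
    by (simp add: vec_eq_iff matrix_vector_mult_def scaleR_sum_right)
  have "distr gaussian_direction borel ((*v) U)
      = distr complex_gaussian borel (\<lambda>z. (U *v z) /\<^sub>R norm (U *v z))"
    by (simp add: gaussian_direction_def distr_distr o_def scale norm_unitary[OF U])
  also have "\<dots> = distr (distr complex_gaussian borel ((*v) U)) borel (\<lambda>z. z /\<^sub>R norm z)"
    by (simp add: distr_distr o_def)
  also have "\<dots> = gaussian_direction"
    by (simp only: complex_gaussian_unitary_invariant[OF U] gaussian_direction_def)
  finally show "distr gaussian_direction borel ((*v) U) = gaussian_direction" .
qed

section \<open>Relative weights of a Haar-distributed vector\<close>

text \<open>
  The filtered weights as a function of the coordinates \<open>w\<close> in the eigenbasis; \<open>\<phi>\<close> translates the
  numbers of the basis vectors into indices of \<open>w\<close>.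
\<close>

definition relative_weights :: "'i set \<Rightarrow> ('i \<Rightarrow> real) \<Rightarrow> ('i \<Rightarrow> 'n) \<Rightarrow> complex ^ 'n \<Rightarrow> 'i \<Rightarrow> real" where
  "relative_weights I a \<phi> w = normalize_sum I (\<lambda>i\<in>I. a i * (cmod (w $ \<phi> i))\<^sup>2)"

lemma measurable_relative_weights [measurable]:
  "relative_weights I a \<phi> \<in> measurable borel (PiM I (\<lambda>_. borel))"
  unfolding relative_weights_def
  by (rule measurable_compose[OF _ measurable_normalize_sum[where M = "\<lambda>_. borel"]]) measurable

lemma relative_weights_scale:
  assumes "c \<noteq> 0"
  shows "relative_weights I a \<phi> (c *\<^sub>R w) = relative_weights I a \<phi> w"
proof -
  have rw: "relative_weights I a \<phi> v
      = (\<lambda>i\<in>I. a i * (cmod (v $ \<phi> i))\<^sup>2 / (\<Sum>j\<in>I. a j * (cmod (v $ \<phi> j))\<^sup>2))" for v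
    by (simp add: relative_weights_def normalize_sum_def fun_eq_iff)
  have eq: "a i * (cmod ((c *\<^sub>R w) $ \<phi> i))\<^sup>2 = c\<^sup>2 * (a i * (cmod (w $ \<phi> i))\<^sup>2)" for i
    by (simp add: power_mult_distrib)
  show ?thesis
    unfolding rw eq sum_distrib_left[symmetric] using assms by simp
qed

text \<open>
  The weights are homogeneous of degree \<open>0\<close>, so a Haar-distributed vector may be replaced by a
  Gaussian vector, whose coordinates are independent; the numbers \<open>a i * (cmod z\<^sub>i)\<^sup>2\<close> are then
  independent exponential variables with rates \<open>1 / a i\<close>.
\<close>

lemma distr_relative_weights_haar:
  fixes \<mu> :: "(complex ^ 'n) measure" and \<psi> :: "'n \<Rightarrow> nat"
  assumes \<mu>: "haar_sphere \<mu>" and \<psi>: "bij_betw \<psi> UNIV {1..CARD('n)}"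
    and a: "\<And>i. a i > 0"
  defines "n \<equiv> CARD('n)"
  shows "distr \<mu> (PiM {1..n} (\<lambda>_. borel)) (relative_weights {1..n} a (inv \<psi>))
      = density (simplex_measure n)
          (\<lambda>p. ennreal (fact (n - 1) * (\<Prod>i=1..n. 1 / a i) / (\<Sum>i=1..n. p i * (1 / a i)) ^ n))"
proof -
  let ?B = "PiM {1..n} (\<lambda>_. borel :: real measure)"
  let ?N = "PiM {1..n} (\<lambda>_. std_complex_normal)"
  let ?R = "relative_weights {1..n} a (inv \<psi>)"
  let ?v = "\<lambda>x. \<chi> j. x (\<psi> j) :: complex ^ 'n"
  let ?sq = "\<lambda>x. \<lambda>i\<in>{1..n}. a i * (cmod (x i))\<^sup>2"
  have n: "n \<ge> 1" by (simp add: n_def Suc_le_eq One_nat_def)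
  note \<psi> = \<psi>[folded n_def]
  have \<psi>_in: "\<psi> j \<in> {1..n}" for j using \<psi> by (auto simp: bij_betw_def)
  from measurable_component_singleton[OF this, where M = "\<lambda>_. std_complex_normal"]
  have v: "?v \<in> borel_measurable ?N"
    by (intro measurable_vec_lambda) (simp cong: measurable_cong_sets)
  have sq: "?sq \<in> measurable ?N ?B" by measurable
  have \<psi>_inv: "\<psi> (inv \<psi> i) = i" if "i \<in> {1..n}" for i
    using \<psi> that by (simp add: bij_betw_def f_inv_into_f)
  have "\<mu> = gaussian_direction"
    by (rule haar_sphere_unique[OF \<mu> haar_sphere_gaussian_direction])
  then have "distr \<mu> ?B ?R = distr complex_gaussian ?B (\<lambda>z. ?R (z /\<^sub>R norm z))"
    by (simp add: gaussian_direction_def distr_distr o_def)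
  also have "(\<lambda>z. ?R (z /\<^sub>R norm z)) = ?R"
  proof
    show "?R (z /\<^sub>R norm z) = ?R z" for z
      by (cases "z = 0") (simp_all add: relative_weights_scale)
  qed
  also have "distr complex_gaussian ?B ?R = distr ?N ?B (\<lambda>x. ?R (?v x))"
    unfolding complex_gaussian_eq_distr_PiM[OF \<psi>, symmetric]
    using v by (simp add: distr_distr o_def)
  also have "(\<lambda>x. ?R (?v x)) = (\<lambda>x. normalize_sum {1..n} (?sq x))"
    by (simp add: relative_weights_def \<psi>_inv fun_eq_iff cong: restrict_cong)
  also have "distr ?N ?B \<dots> = distr (distr ?N ?B ?sq) ?B (normalize_sum {1..n})"
    using sq measurable_normalize_sum[of "\<lambda>_. borel" "{1..n}"] by (simp add: distr_distr o_def)
  also have "distr ?N ?B ?sq = PiM {1..n} (\<lambda>i. density lborel (exponential_density (1 / a i)))"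
  proof -
    have "distr ?N ?B ?sq = PiM {1..n} (\<lambda>i. distr std_complex_normal borel (\<lambda>z. a i * (cmod z)\<^sup>2))"
      using a by (intro distr_PiM_coordinatewise)
        (simp_all add: prob_space_imp_sigma_finite prob_space_std_complex_normal
          prob_space.prob_space_distr)
    then show ?thesis by (simp add: distr_std_complex_normal_norm_sq[OF a])
  qed
  also have "distr \<dots> ?B (normalize_sum {1..n}) = density (simplex_measure n)
      (\<lambda>p. ennreal (fact (n - 1) * (\<Prod>i=1..n. 1 / a i) / (\<Sum>i=1..n. p i * (1 / a i)) ^ n))"
    using a by (intro distr_normalized_exponentials[OF n]) simp
  finally show ?thesis .
qed

section \<open>Diagonalisation of the filter\<close>

lemma poly_mat_eigenvector:
  assumes "A *v x = l *s x"
  shows "poly_mat q A *v x = poly q l *s x"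
proof -
  have pow: "mat_power A k *v x = l ^ k *s x" for k
  proof (induction k)
    case (Suc k)
    have "mat_power A (Suc k) *v x = A *v (l ^ k *s x)"
      by (simp flip: Suc.IH add: matrix_vector_mul_assoc)
    also have "\<dots> = l ^ k *s (A *v x)" by (rule vec.scale)
    finally show ?case by (simp add: assms mult.commute)
  qed simp
  have sum: "(\<Sum>k\<in>K. B k) *v x = (\<Sum>k\<in>K. B k *v x)" if "finite K" for K :: "nat set" and B
    using that by induction (simp_all add: matrix_vector_mult_add_rdistrib)
  have scale: "map_matrix ((*) c) B *v x = c *s (B *v x)" for c B
    by (simp add: vec_eq_iff map_matrix_def matrix_vector_mult_def sum_distrib_left mult.assoc)
  show ?thesis
    by (simp add: poly_mat_def sum scale pow poly_altdef vec_eq_iff sum_distrib_right mult.assoc)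
qed

text \<open>
  The change of coordinates from the standard basis to the basis \<open>f\<close>, if that basis is orthonormal.
\<close>

definition eigenbasis_mat :: "('n \<Rightarrow> complex ^ 'n) \<Rightarrow> complex ^ 'n ^ 'n" where
  "eigenbasis_mat f = (\<chi> j k. cnj (f j $ k))"

lemma unitary_eigenbasis_mat:
  fixes f :: "'n::finite \<Rightarrow> complex ^ 'n"
  assumes "\<And>i j. hinner (f i) (f j) = (if i = j then 1 else 0)"
  shows "unitary_mat (eigenbasis_mat f)"
proof -
  have "eigenbasis_mat f ** adjoint_mat (eigenbasis_mat f) = mat 1"
    using assms by (simp add: vec_eq_iff eigenbasis_mat_def adjoint_mat_def transpose_def map_matrix_def
        matrix_matrix_mult_def hinner_def mat_def)
  then show ?thesis
    unfolding unitary_mat_def using matrix_left_right_inverse by blast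
qed

text \<open>
  In the coordinates of the eigenbasis the matrix of \<open>poly_mat q A\<close> is diagonal: with
  \<open>W = eigenbasis_mat f\<close> one has \<open>poly_mat q A ** W\<^sup>* = W\<^sup>* ** D\<close> because the columns of \<open>W\<^sup>*\<close> are the
  eigenvectors.
\<close>

lemma hinner_poly_mat:
  fixes f :: "'n::finite \<Rightarrow> complex ^ 'n"
  assumes f: "\<And>i j. hinner (f i) (f j) = (if i = j then 1 else 0)"
    and eig: "\<And>j. A *v f j = l j *s f j"
  shows "hinner (f j) (poly_mat q A *v u) = poly q (l j) * hinner (f j) u"
proof -
  let ?W = "eigenbasis_mat f" and ?B = "poly_mat q A"
  let ?D = "(\<chi> i j. if i = j then poly q (l j) else 0) :: complex ^ 'n ^ 'n"
  note W = unitary_eigenbasis_mat[OF f]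
  have Wv: "(?W *v x) $ j = hinner (f j) x" for x j
    by (simp add: eigenbasis_mat_def hinner_matrix)
  have "?B ** adjoint_mat ?W = adjoint_mat ?W ** ?D"
  proof -
    have "(?B ** adjoint_mat ?W) $ k $ j = (?B *v f j) $ k" for k j
      by (simp add: eigenbasis_mat_def adjoint_mat_def transpose_def map_matrix_def
          matrix_matrix_mult_def matrix_vector_mult_def)
    moreover have "(adjoint_mat ?W ** ?D) $ k $ j = poly q (l j) * f j $ k" for k j
      by (simp add: eigenbasis_mat_def adjoint_mat_def transpose_def map_matrix_def
          matrix_matrix_mult_def if_distrib cong: if_cong)
    ultimately show ?thesis
      by (simp add: vec_eq_iff poly_mat_eigenvector[OF eig])
  qed
  then have "?B *v (adjoint_mat ?W *v (?W *v u)) = adjoint_mat ?W *v (?D *v (?W *v u))"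
    by (simp add: matrix_vector_mul_assoc matrix_mul_assoc)
  then have "?W *v (?B *v u) = ?D *v (?W *v u)"
    by (simp add: unitary_adjoint_cancel[OF W])
  then have "(?W *v (?B *v u)) $ j = (?D *v (?W *v u)) $ j" by simp
  then show ?thesis
    by (simp add: Wv) (simp add: matrix_vector_mult_def[of ?D] Wv if_distrib[where f = "\<lambda>x. x * _"] cong: if_cong)
qed

lemma filtered_weights_eq_relative_weights:
  fixes A :: "complex ^ 'n ^ 'n" and \<psi> :: "'n \<Rightarrow> nat"
  assumes basis: "orthonormal_eigenbasis A e lam"
    and \<psi>: "bij_betw \<psi> UNIV {1..CARD('n)}"
    and a: "\<And>i. i \<in> {1..CARD('n)} \<Longrightarrow> a i = (cmod (poly q (lam i)))\<^sup>2"
  shows "filtered_weights A e q u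
      = relative_weights {1..CARD('n)} a (inv \<psi>) (eigenbasis_mat (e \<circ> \<psi>) *v u)"
proof -
  let ?I = "{1..CARD('n)}" and ?W = "eigenbasis_mat (e \<circ> \<psi>)" and ?B = "poly_mat q A"
  have \<psi>_in: "\<psi> j \<in> ?I" for j using \<psi> by (auto simp: bij_betw_def)
  have \<psi>_inv: "\<psi> (inv \<psi> i) = i" if "i \<in> ?I" for i
    using \<psi> that by (simp add: bij_betw_def f_inv_into_f)
  have inj: "\<psi> i = \<psi> j \<longleftrightarrow> i = j" for i j using \<psi> by (auto simp: bij_betw_def inj_def)
  have orth: "hinner ((e \<circ> \<psi>) i) ((e \<circ> \<psi>) j) = (if i = j then 1 else 0)" for i j
    using basis \<psi>_in by (simp add: orthonormal_eigenbasis_def inj)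
  have eig: "A *v (e \<circ> \<psi>) j = (lam \<circ> \<psi>) j *s (e \<circ> \<psi>) j" for j
    using basis \<psi>_in by (simp add: orthonormal_eigenbasis_def)
  note W = unitary_eigenbasis_mat[of "e \<circ> \<psi>", OF orth]
  have Wv: "(?W *v x) $ j = hinner (e (\<psi> j)) x" for x j
    by (simp add: eigenbasis_mat_def hinner_matrix)
  have sq: "(cmod (hinner (e i) (?B *v u)))\<^sup>2 = a i * (cmod ((?W *v u) $ inv \<psi> i))\<^sup>2" if "i \<in> ?I" for i
    using hinner_poly_mat[of "e \<circ> \<psi>", OF orth eig, of "inv \<psi> i" q u]
    by (simp add: Wv \<psi>_inv[OF that] a[OF that] norm_mult power_mult_distrib)
  have "(norm (?B *v u))\<^sup>2 = (norm (?W *v (?B *v u)))\<^sup>2"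
    by (simp add: norm_unitary[OF W])
  also have "\<dots> = (\<Sum>j\<in>UNIV. (cmod (hinner (e (\<psi> j)) (?B *v u)))\<^sup>2)"
    by (simp add: norm_vec_def[of "?W *v _"] L2_set_def sum_nonneg Wv)
  also have "\<dots> = (\<Sum>i\<in>?I. (cmod (hinner (e i) (?B *v u)))\<^sup>2)"
    by (rule sum.reindex_bij_betw[OF \<psi>])
  also have "\<dots> = (\<Sum>i\<in>?I. a i * (cmod ((?W *v u) $ inv \<psi> i))\<^sup>2)"
    by (intro sum.cong sq refl)
  finally have norm: "(norm (?B *v u))\<^sup>2 = (\<Sum>i\<in>?I. a i * (cmod ((?W *v u) $ inv \<psi> i))\<^sup>2)" .
  have scale: "hinner x (c *\<^sub>R y) = c *\<^sub>R hinner x y" for x y :: "complex ^ 'n" and c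
    by (simp add: hinner_def scaleR_sum_right)
  have "(cmod (hinner (e i) (filtered_vector A q u)))\<^sup>2
      = a i * (cmod ((?W *v u) $ inv \<psi> i))\<^sup>2 / (\<Sum>i\<in>?I. a i * (cmod ((?W *v u) $ inv \<psi> i))\<^sup>2)" if "i \<in> ?I" for i
    by (simp add: filtered_vector_def scale power_mult_distrib norm_mult sq[OF that] norm[symmetric] field_simps)
  then show ?thesis
    by (simp add: filtered_weights_def relative_weights_def normalize_sum_def fun_eq_iff)
qed

section \<open>The density of the filtered weights\<close>

theorem proposition7p2:
  fixes A :: "complex ^ 'n ^ 'n"
    and e :: "nat \<Rightarrow> complex ^ 'n"
    and lam :: "nat \<Rightarrow> complex"
    and q :: "complex poly"
    and a :: "nat \<Rightarrow> real"
    and M :: "'w measure"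
    and u :: "'w \<Rightarrow> complex ^ 'n"
    and n :: nat
  defines "n \<equiv> CARD('n)"
  assumes "normal_mat A"
    and "orthonormal_eigenbasis A e lam"
    and "\<And>i. i \<in> {1..n} \<Longrightarrow> a i = (cmod (poly q (lam i)))\<^sup>2"
    and "\<And>i. i \<in> {1..n} \<Longrightarrow> a i > 0"
    and "prob_space M"
    and "u \<in> borel_measurable M"
    and "haar_sphere (distr M borel u)"
  shows "distributed M (simplex_measure n) (\<lambda>\<omega>. filtered_weights A e q (u \<omega>))
           (\<lambda>p. ennreal (fact (n - 1) * (\<Prod>i=1..n. inverse (a i)) / (\<Sum>i=1..n. p i / a i) ^ n))"
proof -
  let ?B = "PiM {1..n} (\<lambda>_. borel :: real measure)"
  obtain \<psi> :: "'n \<Rightarrow> nat" where \<psi>: "bij_betw \<psi> UNIV {1..n}"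
    using ex_numbering unfolding n_def by blast
  \<comment> \<open>Outside \<open>{1..n}\<close> nothing is known about \<open>a\<close>; its positive continuation gives a rate for every index.\<close>
  define a' where "a' i = (if i \<in> {1..n} then a i else 1)" for i
  have a': "a' i > 0" for i using assms(5) by (simp add: a'_def)
  have a'_eq: "a' i = a i" if "i \<in> {1..n}" for i using that by (simp add: a'_def)
  define W where "W = eigenbasis_mat (e \<circ> \<psi>)"
  define R where "R = relative_weights {1..n} a' (inv \<psi>)"
  have R [measurable]: "R \<in> measurable borel ?B" by (simp add: R_def)
  note [measurable] = assms(7)
  have weights: "filtered_weights A e q (u \<omega>) = R (W *v u \<omega>)" for \<omega>
    unfolding R_def W_def n_def
    using assms(3,4) \<psi> a'_eq by (intro filtered_weights_eq_relative_weights) (simp_all add: n_def)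
  have "unitary_mat W"
    unfolding W_def
  proof (rule unitary_eigenbasis_mat)
    fix i j
    have "\<psi> i \<in> {1..n}" "\<psi> j \<in> {1..n}" "\<psi> i = \<psi> j \<longleftrightarrow> i = j"
      using \<psi> by (auto simp: bij_betw_def inj_def)
    then show "hinner ((e \<circ> \<psi>) i) ((e \<circ> \<psi>) j) = (if i = j then 1 else 0)"
      using assms(3) by (simp add: orthonormal_eigenbasis_def n_def)
  qed
  then have inv: "distr (distr M borel u) borel ((*v) W) = distr M borel u"
    using assms(8) by (simp add: haar_sphere_def)
  have meas: "(\<lambda>\<omega>. filtered_weights A e q (u \<omega>)) \<in> measurable M ?B"
    unfolding weights by measurable
  have "distr M ?B (\<lambda>\<omega>. filtered_weights A e q (u \<omega>)) = distr (distr (distr M borel u) borel ((*v) W)) ?B R"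
    by (simp add: weights distr_distr o_def)
  also have "\<dots> = density (simplex_measure n)
      (\<lambda>p. ennreal (fact (n - 1) * (\<Prod>i=1..n. 1 / a' i) / (\<Sum>i=1..n. p i * (1 / a' i)) ^ n))"
    unfolding inv R_def n_def
    by (rule distr_relative_weights_haar[OF assms(8) \<psi>[unfolded n_def] a'])
  also have "(\<Prod>i=1..n. 1 / a' i) = (\<Prod>i=1..n. inverse (a i))"
    by (intro prod.cong) (simp_all add: a'_eq inverse_eq_divide)
  also have "(\<lambda>p. \<Sum>i=1..n. p i * (1 / a' i)) = (\<lambda>p. \<Sum>i=1..n. p i / a i)"
    by (intro ext sum.cong) (simp_all add: a'_eq)
  finally have law: "distr M ?B (\<lambda>\<omega>. filtered_weights A e q (u \<omega>)) = density (simplex_measure n)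
      (\<lambda>p. ennreal (fact (n - 1) * (\<Prod>i=1..n. inverse (a i)) / (\<Sum>i=1..n. p i / a i) ^ n))" 
    by (simp add: fun_eq_iff)
  show ?thesis
    unfolding distributed_def
  proof (intro conjI)
    show "distr M (simplex_measure n) (\<lambda>\<omega>. filtered_weights A e q (u \<omega>)) = density (simplex_measure n)
      (\<lambda>p. ennreal (fact (n - 1) * (\<Prod>i=1..n. inverse (a i)) / (\<Sum>i=1..n. p i / a i) ^ n))"
      unfolding law[symmetric] by (rule distr_cong) (simp_all add: sets_simplex_measure)
    show "(\<lambda>\<omega>. filtered_weights A e q (u \<omega>)) \<in> measurable M (simplex_measure n)"
      using meas by (simp add: measurable_cong_sets[OF refl sets_simplex_measure])
    show "(\<lambda>p. ennreal (fact (n - 1) * (\<Prod>i=1..n. inverse (a i)) / (\<Sum>i=1..n. p i / a i) ^ n))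
        \<in> borel_measurable (simplex_measure n)"
      unfolding measurable_cong_sets[OF sets_simplex_measure refl] by measurable
  qed
qed

end
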